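(* Let $n,M\ge1$, let $\mu$, $\phi_{r,r+1}$ ($-M\le r<M$), $x^{-M},x^{M}\in\mathbb{R}^n$ be as in the context, with $Z_{n,M}\neq0$. Then for all integers $0\le k_r\le n$, $|r|<M$, the correlation functions are given by $$R_{k_{-M+1},\dots,k_{M-1}}(x_1^{-M+1},\dots,x_{k_{-M+1}}^{-M+1},\dots,x_1^{M-1},\dots,x_{k_{M-1}}^{M-1})=\det\big(K^{n,M}(r,x_{i}^r;s,x_{j}^s)\big)_{-M<r,s<M,\;1\le i\le k_r,\;1\le j\le k_s},$$ where the determinant on the right has a block structure, with the block indexed by $(r,s)$ having size $k_r\times k_s$.
   Context: Let $\mu$ be a reference measure on $\mathbb{R}$ (typically Lebesgue or counting measure). For $-M\le r<M$ let $\phi_{r,r+1}:\mathbb{R}^2\to\mathbb{C}$ be transition weights with $|\phi_{r,r+1}(x,y)|\le c_r(x)d_r(y)$, $c_r\in L^1(\mathbb{R},\mu)$, $d_r\in L^\infty(\mathbb{R},\mu)$. Write $x^r=(x_1^r,\dots,x_n^r)\in\mathbb{R}^n$; $x^{-M}$ (initial) and $x^M$ (final) are fixed, and $\bar x=(x^{-M+1},\dots,x^{M-1})$. The weight of $\bar x$ is $$w_{n,M}(\bar x)=\prod_{r=-M}^{M-1}\det(\phi_{r,r+1}(x_i^r,x_j^{r+1}))_{i,j=1}^n ,$$ $d\mu(\bar x)=\prod_{r=-M+1}^{M-1}\prod_{j=1}^n d\mu(x_j^r)$, the partition function is $Z_{n,M}=\frac1{(n!)^{2M-1}}\int_{(\mathbb{R}^n)^{2M-1}}w_{n,M}(\bar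 x)\,d\mu(\bar x)$, assumed nonzero, and $p_{n,M}(\bar x)=w_{n,M}(\bar x)/((n!)^{2M-1}Z_{n,M})$. The correlation functions are $$R_{k_{-M+1},\dots,k_{M-1}}(x_1^{-M+1},\dots,x_{k_{M-1}}^{M-1})=\int_{\mathbb{R}^{n(2M-1)-k}}p_{n,M}(\bar x)\prod_{r=-M+1}^{M-1}\frac{n!}{(n-k_r)!}\prod_{j=k_r+1}^n d\mu(x_j^r),\quad k=\sum_r k_r.$$ For $r<s$, $\phi_{r,s}=\phi_{r,r+1}*\cdots*\phi_{s-1,s}$, where $(\phi*\psi)(x,y)=\int_{\mathbb{R}}\phi(x,z)\psi(z,y)\,d\mu(z)$; $\phi_{r,s}\equiv0$ if $r\ge s$. Let $A$ be the $n\times n$ matrix $A_{ij}=\phi_{-M,M}(x_i^{-M},x_j^M)$; then $Z_{n,M}=\det A$, so $A$ is invertible. For $-M<r,s<M$, $x,y\in\mathbb{R}$, $$K^{n,M}(r,x;s,y)=\sum_{i,j=1}^n\phi_{r,M}(x,x_i^M)(A^{-1})_{ij}\phi_{-M,s}(x_j^{-M},y)-\phi_{r,s}(x,y).$$ *)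

theory Defs
  imports
    "HOL-Analysis.Finite_Product_Measure"
    "HOL-Analysis.Bochner_Integration"
    "Jordan_Normal_Form.Determinant"
    "Jordan_Normal_Form.Gauss_Jordan_Elimination"
begin

text \<open>
  Conventions: \<open>\<phi> r\<close> is the one-step transition weight \<open>\<phi>\<^sub>r\<^sub>,\<^sub>r\<^sub>+\<^sub>1\<close>, relevant only for
  \<open>-M \<le> r < M\<close>. Particles are numbered from 0, so the particle \<open>x\<^sub>j\<close> with \<open>1 \<le> j \<le> n\<close> is the
  one with number \<open>j - 1\<close>. The initial and final points \<open>x\<^sup>-\<^sup>M\<close> and \<open>x\<^sup>M\<close> are given by functions
  \<open>a\<close> and \<open>b\<close>, of which only the values at numbers \<open>< n\<close> matter. A configuration of the
  intermediate times is a function \<open>x\<close> on pairs (time, particle number).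
\<close>

definition config_index :: "nat \<Rightarrow> nat \<Rightarrow> (int \<times> nat) set" where
  "config_index n M = {- int M <..< int M} \<times> {..<n}"

definition position ::
    "nat \<Rightarrow> (nat \<Rightarrow> real) \<Rightarrow> (nat \<Rightarrow> real) \<Rightarrow> (int \<times> nat \<Rightarrow> real) \<Rightarrow> int \<Rightarrow> nat \<Rightarrow> real" where
  "position M a b x r j = (if r = - int M then a j else if r = int M then b j else x (r, j))"

definition path_weight ::
    "(int \<Rightarrow> real \<Rightarrow> real \<Rightarrow> complex) \<Rightarrow> nat \<Rightarrow> nat \<Rightarrow> (nat \<Rightarrow> real) \<Rightarrow> (nat \<Rightarrow> real)
      \<Rightarrow> (int \<times> nat \<Rightarrow> real) \<Rightarrow> complex" where
  "path_weight \<phi> n M a b x =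
    (\<Prod>r\<in>{- int M..<int M}. Determinant.det (Matrix.mat n n
      (\<lambda>(i, j). \<phi> r (position M a b x r i) (position M a b x (r + 1) j))))"

definition partition_function ::
    "real measure \<Rightarrow> (int \<Rightarrow> real \<Rightarrow> real \<Rightarrow> complex) \<Rightarrow> nat \<Rightarrow> nat
      \<Rightarrow> (nat \<Rightarrow> real) \<Rightarrow> (nat \<Rightarrow> real) \<Rightarrow> complex" where
  "partition_function \<mu> \<phi> n M a b =
    1 / fact n ^ (2 * M - 1) *
      (\<integral>x. path_weight \<phi> n M a b x \<partial>(\<Pi>\<^sub>M p\<in>config_index n M. \<mu>))"

definition path_density ::
    "real measure \<Rightarrow> (int \<Rightarrow> real \<Rightarrow> real \<Rightarrow> complex) \<Rightarrow> nat \<Rightarrow> nat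
      \<Rightarrow> (nat \<Rightarrow> real) \<Rightarrow> (nat \<Rightarrow> real) \<Rightarrow> (int \<times> nat \<Rightarrow> real) \<Rightarrow> complex" where
  "path_density \<mu> \<phi> n M a b x =
    path_weight \<phi> n M a b x / (fact n ^ (2 * M - 1) * partition_function \<mu> \<phi> n M a b)"

text \<open>
  The first \<open>k r\<close> particles at time \<open>r\<close> are held fixed at the positions given by \<open>x\<close>, the
  remaining ones (collected in \<open>y\<close>) are integrated out.
\<close>

definition fixed_index :: "nat \<Rightarrow> (int \<Rightarrow> nat) \<Rightarrow> (int \<times> nat) set" where
  "fixed_index M k = (SIGMA r:{- int M <..< int M}. {..<k r})"

definition free_index :: "nat \<Rightarrow> nat \<Rightarrow> (int \<Rightarrow> nat) \<Rightarrow> (int \<times> nat) set" where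
  "free_index n M k = (SIGMA r:{- int M <..< int M}. {k r..<n})"

definition correlation_function ::
    "real measure \<Rightarrow> (int \<Rightarrow> real \<Rightarrow> real \<Rightarrow> complex) \<Rightarrow> nat \<Rightarrow> nat
      \<Rightarrow> (nat \<Rightarrow> real) \<Rightarrow> (nat \<Rightarrow> real) \<Rightarrow> (int \<Rightarrow> nat) \<Rightarrow> (int \<times> nat \<Rightarrow> real) \<Rightarrow> complex" where
  "correlation_function \<mu> \<phi> n M a b k x =
    (\<integral>y. path_density \<mu> \<phi> n M a b (merge (fixed_index M k) (free_index n M k) (x, y)) *
        (\<Prod>r\<in>{- int M <..< int M}. fact n / fact (n - k r))
      \<partial>(\<Pi>\<^sub>M p\<in>free_index n M k. \<mu>))"

definition convolution ::
    "real measure \<Rightarrow> (real \<Rightarrow> real \<Rightarrow> complex) \<Rightarrow> (real \<Rightarrow> real \<Rightarrow> complex)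
      \<Rightarrow> real \<Rightarrow> real \<Rightarrow> complex" where
  "convolution \<mu> f g x y = (\<integral>z. f x z * g z y \<partial>\<mu>)"

text \<open>
  \<open>iterated_weight \<mu> \<phi> r m\<close> is the convolution of the \<open>m + 1\<close> weights
  \<open>\<phi> r, \<dots>, \<phi> (r + m)\<close>, i.e. \<open>\<phi>\<^sub>r\<^sub>,\<^sub>s\<close> for \<open>s = r + m + 1\<close>.
\<close>

primrec iterated_weight ::
    "real measure \<Rightarrow> (int \<Rightarrow> real \<Rightarrow> real \<Rightarrow> complex) \<Rightarrow> int \<Rightarrow> nat
      \<Rightarrow> real \<Rightarrow> real \<Rightarrow> complex" where
  "iterated_weight \<mu> \<phi> r 0 = \<phi> r"
| "iterated_weight \<mu> \<phi> r (Suc m) =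
    convolution \<mu> (iterated_weight \<mu> \<phi> r m) (\<phi> (r + int (Suc m)))"

definition transition ::
    "real measure \<Rightarrow> (int \<Rightarrow> real \<Rightarrow> real \<Rightarrow> complex) \<Rightarrow> int \<Rightarrow> int
      \<Rightarrow> real \<Rightarrow> real \<Rightarrow> complex" where
  "transition \<mu> \<phi> r s =
    (if r < s then iterated_weight \<mu> \<phi> r (nat (s - r - 1)) else (\<lambda>x y. 0))"

definition end_matrix ::
    "real measure \<Rightarrow> (int \<Rightarrow> real \<Rightarrow> real \<Rightarrow> complex) \<Rightarrow> nat \<Rightarrow> nat
      \<Rightarrow> (nat \<Rightarrow> real) \<Rightarrow> (nat \<Rightarrow> real) \<Rightarrow> complex Matrix.mat" where
  "end_matrix \<mu> \<phi> n M a b =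
    Matrix.mat n n (\<lambda>(i, j). transition \<mu> \<phi> (- int M) (int M) (a i) (b j))"

text \<open>
  \<open>mat_inverse\<close> returns \<open>None\<close> on singular matrices; a nonzero partition function implies that
  \<open>end_matrix\<close> is invertible, since its determinant is the partition function.
\<close>

definition correlation_kernel ::
    "real measure \<Rightarrow> (int \<Rightarrow> real \<Rightarrow> real \<Rightarrow> complex) \<Rightarrow> nat \<Rightarrow> nat
      \<Rightarrow> (nat \<Rightarrow> real) \<Rightarrow> (nat \<Rightarrow> real) \<Rightarrow> int \<Rightarrow> real \<Rightarrow> int \<Rightarrow> real \<Rightarrow> complex" where
  "correlation_kernel \<mu> \<phi> n M a b r x s y =
    (\<Sum>i<n. \<Sum>j<n. transition \<mu> \<phi> r (int M) x (b i) *
        (the (mat_inverse (end_matrix \<mu> \<phi> n M a b)) $$ (i, j)) *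
        transition \<mu> \<phi> (- int M) s (a j) y)
     - transition \<mu> \<phi> r s x y"

text \<open>
  Rows and columns of the block matrix are labelled by the pairs \<open>(r, i)\<close> with \<open>-M < r < M\<close> and
  \<open>i < k r\<close>, listed block by block; the block \<open>(r, s)\<close> has size \<open>k r \<times> k s\<close> and entries
  \<open>f (r, i) (s, j)\<close>.
\<close>

definition block_labels :: "nat \<Rightarrow> (int \<Rightarrow> nat) \<Rightarrow> (int \<times> nat) list" where
  "block_labels M k = [(r, i). r \<leftarrow> [- int M + 1..int M - 1], i \<leftarrow> [0..<k r]]"

definition block_matrix ::
    "nat \<Rightarrow> (int \<Rightarrow> nat) \<Rightarrow> (int \<times> nat \<Rightarrow> int \<times> nat \<Rightarrow> complex) \<Rightarrow> complex Matrix.mat" where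
  "block_matrix M k f =
    Matrix.mat (length (block_labels M k)) (length (block_labels M k))
      (\<lambda>(p, q). f (block_labels M k ! p) (block_labels M k ! q))"

end

theory Submission
  imports Defs
begin

text \<open>
  For a set \<open>P\<close> of space-time points, let \<open>D(P)\<close> be the determinant of the transition weights
  \<open>\<phi>\<^sub>r\<^sub>,\<^sub>s\<close> whose rows are the initial points and \<open>P\<close> and whose columns are the final points and \<open>P\<close>.
  Since \<open>\<phi>\<^sub>r\<^sub>,\<^sub>s = 0\<close> for \<open>r \<ge> s\<close>, for a full configuration this matrix is block triangular up to a
  cyclic shift of the columns, and \<open>D\<close> is the weight up to a constant sign.

  Integrating a point \<open>z\<close> at time \<open>s\<close> out of \<open>D(P \<union> {z})\<close> merges, by the convolution property, the two
  edges at \<open>z\<close> into an edge that crosses time \<open>s\<close>. Conversely \<open>z\<close> can be inserted into any crossing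
  edge of a permutation, at the cost of a sign, and each nonvanishing permutation has \<open>n - m\<close> crossing
  edges, where \<open>m\<close> is the number of points of \<open>P\<close> at time \<open>s\<close>. Hence the integral is \<open>-(n - m) D(P)\<close>,
  and iterating it yields both the partition function and the correlation functions. A Schur complement
  finally gives \<open>D(P) = (-1)\<^bsup>|P|\<^esup> det A det K\<close>. The constant sign cancels in the
  quotient.
\<close>

section \<open>Determinants over finite index sets\<close>

text \<open>Rows and columns share one unordered index set, so that a point can be added or removed
  without renumbering the others.\<close>

definition set_det :: "'a set \<Rightarrow> ('a \<Rightarrow> 'a \<Rightarrow> 'b::comm_ring_1) \<Rightarrow> 'b" where
  "set_det I f = (\<Sum>p | p permutes I. of_int (sign p) * (\<Prod>u\<in>I. f u (p u)))"

lemma set_det_cong: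
  assumes "\<And>u v. u \<in> I \<Longrightarrow> v \<in> I \<Longrightarrow> f u v = g u v"
  shows "set_det I f = set_det I g"
  unfolding set_det_def
  by (intro sum.cong refl arg_cong2[of _ _ _ _ "(*)"] prod.cong) (auto simp: assms permutes_in_image)

lemma set_det_empty [simp]: "set_det {} f = 1"
  by (simp add: set_det_def)

text \<open>Conjugation by \<open>g\<close> carries the permutations of \<open>A\<close> bijectively
  to those of \<open>B\<close> and preserves signs.\<close>

lemma set_det_reindex:
  assumes g: "bij_betw g A B" and A: "finite A"
  shows "set_det B f = set_det A (\<lambda>u v. f (g u) (g v))"
proof -
  have inj: "inj_on g A" and B: "B = g ` A" using g by (auto simp: bij_betw_def)
  \<comment> \<open>The library states the bijection with the expanded form and the sign with
    \<open>map_permutation\<close>; this links the two.\<close>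
  have eq: "map_permutation A g = (\<lambda>\<pi> x. if x \<in> B then g (\<pi> (inv_into A g x)) else x)"
    by (simp add: fun_eq_iff map_permutation_def restrict_id_def B)
  have "set_det B f =
    (\<Sum>p | p permutes A. of_int (sign (map_permutation A g p)) * (\<Prod>u\<in>B. f u (map_permutation A g p u)))"
    unfolding set_det_def eq
    by (rule sum.reindex_bij_betw[symmetric, OF bij_betw_permutations[OF g]])
  also have "\<dots> = set_det A (\<lambda>u v. f (g u) (g v))"
    unfolding set_det_def B
    by (intro sum.cong refl)
       (simp add: sign_map_permutation[OF inj _ A] prod.reindex[OF inj] map_permutation_apply[OF inj])
  finally show ?thesis .
qed

lemma set_det_conv_det:
  assumes "distinct xs"
  shows "set_det (set xs) f =
    Determinant.det (mat (length xs) (length xs) (\<lambda>(i, j). f (xs ! i) (xs ! j)))"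
proof -
  have "bij_betw ((!) xs) {0..<length xs} (set xs)"
    using bij_betw_nth[OF assms] by (simp add: atLeast0LessThan)
  then show ?thesis
    by (subst set_det_reindex[where A="{0..<length xs}"])
       (auto simp: set_det_def det_def permutes_in_image intro!: sum.cong prod.cong)
qed

text \<open>Substitute \<open>c \<circ> p\<close> for \<open>p\<close> in the sum. The lemma serves
  to shift the columns in time by \<open>advance\<close>.\<close>

lemma set_det_compose:
  assumes "c permutes I" "finite I"
  shows "set_det I f = of_int (sign c) * set_det I (\<lambda>u v. f u (c v))"
proof -
  have c: "permutation c" using assms permutation_permutes by blast
  have "set_det I f = (\<Sum>p | p permutes I. of_int (sign (c \<circ> p)) * (\<Prod>u\<in>I. f u ((c \<circ> p) u)))"
    unfolding set_det_def by (rule setum_permutations_compose_left[OF assms(1)])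
  also have "\<dots> = of_int (sign c) * set_det I (\<lambda>u v. f u (c v))"
    unfolding set_det_def sum_distrib_left
  proof (intro sum.cong refl)
    fix p assume "p \<in> {p. p permutes I}"
    then have "permutation p" using assms permutation_permutes by blast
    then show "of_int (sign (c \<circ> p)) * (\<Prod>u\<in>I. f u ((c \<circ> p) u)) =
        of_int (sign c) * (of_int (sign p) * (\<Prod>u\<in>I. f u (c (p u))))"
      using c by (simp add: sign_compose)
  qed
  finally show ?thesis .
qed

text \<open>Enumerating \<open>A\<close> first and \<open>B\<close> second yields a block matrix
  whose lower left block is zero.\<close>

lemma set_det_Un_triangular:
  fixes f :: "'a \<Rightarrow> 'a \<Rightarrow> 'b::idom"
  assumes "finite A" "finite B" "A \<inter> B = {}"
    and zero: "\<And>u v. u \<in> B \<Longrightarrow> v \<in> A \<Longrightarrow> f u v = 0"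
  shows "set_det (A \<union> B) f = set_det A f * set_det B f"
proof -
  obtain xs ys where xs: "set xs = A" "distinct xs" and ys: "set ys = B" "distinct ys"
    using assms finite_distinct_list by metis
  let ?m = "length xs" and ?l = "length ys"
  let ?F = "\<lambda>us vs. mat (length us) (length vs) (\<lambda>(i, j). f (us ! i) (vs ! j))"
  have "set_det (A \<union> B) f = Determinant.det (?F (xs @ ys) (xs @ ys))"
    using set_det_conv_det[of "xs @ ys" f] xs ys assms(3) by auto
  also have "?F (xs @ ys) (xs @ ys) =
      four_block_mat (?F xs xs) (?F xs ys) (0\<^sub>m ?l ?m) (?F ys ys)"
    using nth_mem[of _ xs] nth_mem[of _ ys] xs(1) ys(1)
    by (intro eq_matI) (auto simp: nth_append intro!: zero)
  also have "Determinant.det \<dots> = Determinant.det (?F xs xs) * Determinant.det (?F ys ys)"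
    by (rule det_four_block_mat_lower_left_zero) auto
  finally show ?thesis
    using set_det_conv_det[of xs f] set_det_conv_det[of ys f] xs ys by simp
qed

text \<open>Induction on the largest value \<open>s\<close> of \<open>t\<close>: rows with value
  \<open>s\<close> vanish in all columns of smaller value, so they split off as the last diagonal
  block.\<close>

lemma set_det_block_triangular:
  fixes f :: "'a \<Rightarrow> 'a \<Rightarrow> 'b::idom" and t :: "'a \<Rightarrow> 'c::linorder"
  assumes "finite T" "finite I" "t ` I \<subseteq> T"
    and "\<And>u v. u \<in> I \<Longrightarrow> v \<in> I \<Longrightarrow> t v < t u \<Longrightarrow> f u v = 0"
  shows "set_det I f = (\<Prod>s\<in>T. set_det {u \<in> I. t u = s} f)"
  using assms
proof (induction T arbitrary: I rule: finite_linorder_max_induct)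
  case empty
  then show ?case by simp
next
  case (insert s T)
  let ?A = "{u \<in> I. t u \<noteq> s}" and ?B = "{u \<in> I. t u = s}"
  have s: "s \<notin> T" using insert.hyps by auto
  have "set_det I f = set_det (?A \<union> ?B) f"
    by (rule arg_cong[of _ _ "\<lambda>I. set_det I f"]) auto
  also have "\<dots> = set_det ?A f * set_det ?B f"
    using insert by (intro set_det_Un_triangular) force+
  also have "set_det ?A f = (\<Prod>s\<in>T. set_det {u \<in> ?A. t u = s} f)"
    using insert.prems by (intro insert.IH) auto
  also have "\<dots> = (\<Prod>s\<in>T. set_det {u \<in> I. t u = s} f)"
    using s by (intro prod.cong arg_cong[of _ _ "\<lambda>I. set_det I f"]) auto
  finally show ?case
    using s insert.hyps(1) by (simp add: mult.commute)
qed

text \<open>Permutations fixing \<open>z\<close> vanish by \<open>zz\<close>. Any other one arises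
  uniquely from a permutation \<open>q\<close> of \<open>Q\<close> by splitting one edge from
  \<open>u\<close> to \<open>q u\<close> into an edge from \<open>u\<close> to \<open>z\<close> and
  one from \<open>z\<close> to \<open>q u\<close>. The splitting is a transposition, hence the minus
  sign.\<close>

lemma set_det_insert:
  assumes Q: "finite Q" "z \<notin> Q" and zz: "f z z = 0"
  shows "set_det (insert z Q) f =
    - (\<Sum>q | q permutes Q. of_int (sign q) *
        (\<Sum>u\<in>Q. f u z * f z (q u) * (\<Prod>v\<in>Q - {u}. f v (q v))))"
proof -
  let ?g = "\<lambda>p. of_int (sign p) * (\<Prod>u\<in>insert z Q. f u (p u))"
  have "set_det (insert z Q) f =
      (\<Sum>b\<in>insert z Q. \<Sum>q | q permutes Q. ?g (Transposition.transpose z b \<circ> q))"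
    unfolding set_det_def by (rule sum_over_permutations_insert[OF Q])
  also have "\<dots> = (\<Sum>q | q permutes Q. \<Sum>b\<in>insert z Q. ?g (Transposition.transpose z b \<circ> q))"
    by (rule sum.swap)
  also have "\<dots> = (\<Sum>q | q permutes Q. - (of_int (sign q) *
        (\<Sum>u\<in>Q. f u z * f z (q u) * (\<Prod>v\<in>Q - {u}. f v (q v)))))"
  proof (intro sum.cong refl)
    fix q assume "q \<in> {q. q permutes Q}"
    then have q: "q permutes Q" by simp
    have qz: "q z = z" using q Q permutes_not_in by metis
    have "?g (Transposition.transpose z z \<circ> q) = 0"
      using Q by (simp add: qz zz)
    then have "(\<Sum>b\<in>insert z Q. ?g (Transposition.transpose z b \<circ> q)) =
        (\<Sum>b\<in>Q. ?g (Transposition.transpose z b \<circ> q))"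
      using Q by simp
    \<comment> \<open>The summation index \<open>b\<close> is the image of \<open>z\<close>; writing
      it as \<open>q u\<close> names the edge that \<open>z\<close> splits.\<close>
    also have "\<dots> = (\<Sum>u\<in>Q. ?g (Transposition.transpose z (q u) \<circ> q))"
      by (rule sum.reindex_bij_betw[symmetric, OF permutes_imp_bij[OF q]])
    also have "\<dots> = (\<Sum>u\<in>Q. - of_int (sign q) * (f u z * f z (q u) * (\<Prod>v\<in>Q - {u}. f v (q v))))"
    proof (intro sum.cong refl)
      fix u assume u: "u \<in> Q"
      then have qu: "q u \<in> Q" using q by (simp add: permutes_in_image)
      have "sign (Transposition.transpose z (q u) \<circ> q) = - sign q"
        using q Q qu permutation_permutes
        by (subst sign_compose) (auto simp: sign_swap_id intro: permutation_swap_id)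
      moreover have "(\<Prod>v\<in>insert z Q. f v ((Transposition.transpose z (q u) \<circ> q) v)) =
          f z (q u) * (f u z * (\<Prod>v\<in>Q - {u}. f v (q v)))"
      proof -
        have "(\<Prod>v\<in>Q - {u}. f v ((Transposition.transpose z (q u) \<circ> q) v)) = (\<Prod>v\<in>Q - {u}. f v (q v))"
        proof (intro prod.cong refl)
          fix v assume v: "v \<in> Q - {u}"
          then have "q v \<noteq> z" using q Q(2) permutes_in_image by (metis DiffD1)
          moreover have "q v \<noteq> q u" using v permutes_inj[OF q] by (auto dest: injD)
          ultimately show "f v ((Transposition.transpose z (q u) \<circ> q) v) = f v (q v)"
            by (simp add: transpose_apply_other)
        qed
        then show ?thesis
          using Q u qz by (simp add: prod.remove[of Q u])
      qed
      ultimately show "?g (Transposition.transpose z (q u) \<circ> q) =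
          - of_int (sign q) * (f u z * f z (q u) * (\<Prod>v\<in>Q - {u}. f v (q v)))"
        by (simp add: algebra_simps)
    qed
    finally show "(\<Sum>b\<in>insert z Q. ?g (Transposition.transpose z b \<circ> q)) =
      - (of_int (sign q) * (\<Sum>u\<in>Q. f u z * f z (q u) * (\<Prod>v\<in>Q - {u}. f v (q v))))"
      by (simp add: sum_distrib_left sum_negf)
  qed
  finally show ?thesis by (simp add: sum_negf)
qed

text \<open>Multiplication on the right by the unitriangular \<open>?U\<close>, of determinant 1,
  clears the upper right block and leaves the Schur complement of \<open>A\<close> in the lower
  right one.\<close>

lemma det_four_block_mat_Schur:
  fixes A :: "'a::idom mat"
  assumes A: "A \<in> carrier_mat n n" and B: "B \<in> carrier_mat n m"
    and C: "C \<in> carrier_mat m n" and D: "D \<in> carrier_mat m m"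
    and A': "A' \<in> carrier_mat n n" "A * A' = 1\<^sub>m n"
  shows "Determinant.det (four_block_mat A B C D) =
    Determinant.det A * Determinant.det (D - C * A' * B)"
proof -
  let ?U = "four_block_mat (1\<^sub>m n) (- (A' * B)) (0\<^sub>m m n) (1\<^sub>m m)"
  have A'B: "A' * B \<in> carrier_mat n m" using A' B by auto
  have AA'B: "A * (A' * B) = B"
    using assoc_mult_mat[OF A A'(1) B] A'(2) B by simp
  have CA'B: "C * (A' * B) = C * A' * B"
    using assoc_mult_mat[OF C A'(1) B] by simp
  have "four_block_mat A B C D * ?U =
      four_block_mat (A * 1\<^sub>m n + B * 0\<^sub>m m n) (A * - (A' * B) + B * 1\<^sub>m m)
        (C * 1\<^sub>m n + D * 0\<^sub>m m n) (C * - (A' * B) + D * 1\<^sub>m m)"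
    by (rule mult_four_block_mat[OF A B C D one_carrier_mat uminus_carrier_mat[OF A'B] zero_carrier_mat one_carrier_mat])
  also have "\<dots> = four_block_mat A (0\<^sub>m n m) C (D - C * A' * B)"
  proof (rule cong_four_block_mat)
    have "A * - (A' * B) = - B"
      by (subst uminus_mult_right_mat) (use A A' AA'B in auto)
    then show "A * - (A' * B) + B * 1\<^sub>m m = 0\<^sub>m n m"
      using uminus_l_inv_mat[OF B] right_mult_one_mat[OF B] by simp
    have "C * - (A' * B) = - (C * A' * B)"
      by (subst uminus_mult_right_mat) (use C A' CA'B in auto)
    then show "C * - (A' * B) + D * 1\<^sub>m m = D - C * A' * B"
      using C B right_mult_one_mat[OF D] D by (simp only:) (intro eq_matI; simp)
  qed (use A B C D in simp_all)
  finally have "Determinant.det (four_block_mat A B C D) * Determinant.det ?U =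
      Determinant.det (four_block_mat A (0\<^sub>m n m) C (D - C * A' * B))"
    using A B C D A'B by (subst det_mult[symmetric, of _ "n + m"]) auto
  moreover have "Determinant.det ?U = 1"
    using A'B by (subst det_four_block_mat_lower_left_zero) auto
  moreover have "Determinant.det (four_block_mat A (0\<^sub>m n m) C (D - C * A' * B)) =
      Determinant.det A * Determinant.det (D - C * A' * B)"
    using A B C D A' by (intro det_four_block_mat_upper_right_zero) auto
  ultimately show ?thesis by simp
qed

section \<open>Regularity and convolution of the transition weights\<close>

lemma integrable_dominated:
  fixes f :: "'a \<Rightarrow> 'b::{banach, second_countable_topology}" and g :: "'a \<Rightarrow> real"
  assumes "integrable N g" "f \<in> borel_measurable N" "\<And>x. norm (f x) \<le> g x"
  shows "integrable N f"
proof (rule Bochner_Integration.integrable_bound[OF assms(1,2)])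
  show "AE x in N. norm (f x) \<le> norm (g x)"
    using assms(3) by (auto intro!: AE_I2 intro: order_trans[OF _ abs_ge_self])
qed

locale transition_weights = sigma_finite_measure \<mu> for \<mu> :: "real measure" +
  fixes \<phi> :: "int \<Rightarrow> real \<Rightarrow> real \<Rightarrow> complex" and M :: nat
    and c d :: "int \<Rightarrow> real \<Rightarrow> real"
  assumes sets_mu: "sets \<mu> = sets borel"
    and weight_measurable: "\<And>r. - int M \<le> r \<Longrightarrow> r < int M \<Longrightarrow>
           (\<lambda>(u, v). \<phi> r u v) \<in> borel_measurable (\<mu> \<Otimes>\<^sub>M \<mu>)"
    and weight_bound: "\<And>r u v. - int M \<le> r \<Longrightarrow> r < int M \<Longrightarrow> norm (\<phi> r u v) \<le> c r u * d r v"
    and c_integrable: "\<And>r. - int M \<le> r \<Longrightarrow> r < int M \<Longrightarrow> integrable \<mu> (c r)"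
    and d_measurable: "\<And>r. - int M \<le> r \<Longrightarrow> r < int M \<Longrightarrow> d r \<in> borel_measurable \<mu>"
    and d_bounded: "\<And>r. - int M \<le> r \<Longrightarrow> r < int M \<Longrightarrow> \<exists>B. AE v in \<mu>. \<bar>d r v\<bar> \<le> B"
begin

sublocale product: product_sigma_finite "\<lambda>_. \<mu>"
  by unfold_locales

sublocale pair: pair_sigma_finite \<mu> \<mu>
  by unfold_locales

lemma space_mu [simp]: "space \<mu> = UNIV"
  using sets_eq_imp_space_eq[OF sets_mu] by simp

text \<open>The factors \<open>c\<close> and \<open>d\<close> may both be negative; with absolute
  values the bounds of several edges can be multiplied.\<close>

lemma weight_bound_abs:
  assumes "- int M \<le> r" "r < int M"
  shows "norm (\<phi> r u v) \<le> \<bar>c r u\<bar> * \<bar>d r v\<bar>"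
proof -
  have "norm (\<phi> r u v) \<le> c r u * d r v" by (rule weight_bound[OF assms])
  also have "\<dots> \<le> \<bar>c r u\<bar> * \<bar>d r v\<bar>" by (metis abs_ge_self abs_mult)
  finally show ?thesis .
qed

text \<open>At a point that is integrated out, the edge ending there contributes a factor
  \<open>d\<close> and the edge starting there a factor \<open>c\<close>. All later integrable
  majorants are built from such products: one factor is essentially bounded, the other
  integrable.\<close>

lemma integrable_d_c:
  assumes "- int M \<le> r" "r < int M" "- int M \<le> s" "s < int M"
  shows "integrable \<mu> (\<lambda>z. \<bar>d r z\<bar> * \<bar>c s z\<bar>)"
proof -
  obtain B where B: "AE v in \<mu>. \<bar>d r v\<bar> \<le> B" using d_bounded[of r] assms by auto
  show ?thesis
  proof (rule Bochner_Integration.integrable_bound)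
    show "integrable \<mu> (\<lambda>z. B * \<bar>c s z\<bar>)"
      using c_integrable[of s] assms by auto
    show "(\<lambda>z. \<bar>d r z\<bar> * \<bar>c s z\<bar>) \<in> borel_measurable \<mu>"
      using c_integrable[of s] d_measurable[of r] assms by auto
    show "AE z in \<mu>. norm (\<bar>d r z\<bar> * \<bar>c s z\<bar>) \<le> norm (B * \<bar>c s z\<bar>)"
      using B by eventually_elim (auto simp: abs_mult intro!: mult_right_mono)
  qed
qed

lemma borel_measurable_section:
  assumes "case_prod f \<in> borel_measurable (\<mu> \<Otimes>\<^sub>M \<mu>)" "g \<in> borel_measurable N" "h \<in> borel_measurable N"
  shows "(\<lambda>z. f (g z) (h z)) \<in> borel_measurable N"
proof -
  have "(\<lambda>z. (g z, h z)) \<in> N \<rightarrow>\<^sub>M \<mu> \<Otimes>\<^sub>M \<mu>"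
    using assms(2,3) by (intro measurable_Pair) (simp_all cong: measurable_cong_sets add: measurable_cong_sets[OF refl sets_mu])
  from measurable_compose[OF this assms(1)] show ?thesis by simp
qed

text \<open>Measurability and bound go into one induction, since the bound on a convolution needs
  its integrand to be measurable. The bound keeps \<open>c\<close> of the first step and
  \<open>d\<close> of the last; the product of \<open>d\<close> and \<open>c\<close> at the
  intermediate point integrates to a constant.\<close>

lemma iterated_weight_regular:
  assumes "- int M \<le> r" "r + int m < int M"
  shows "case_prod (iterated_weight \<mu> \<phi> r m) \<in> borel_measurable (\<mu> \<Otimes>\<^sub>M \<mu>) \<and>
    (\<exists>C\<ge>0. \<forall>u v. norm (iterated_weight \<mu> \<phi> r m u v) \<le> C * (\<bar>c r u\<bar> * \<bar>d (r + int m) v\<bar>))"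
  using assms(2)
proof (induction m)
  case 0
  then show ?case
    using weight_measurable[of r] weight_bound_abs[of r] assms(1) by (auto intro!: exI[of _ 1])
next
  case (Suc m)
  let ?f = "iterated_weight \<mu> \<phi> r m" and ?t = "r + int (Suc m)"
  obtain C where f: "case_prod ?f \<in> borel_measurable (\<mu> \<Otimes>\<^sub>M \<mu>)" and C: "C \<ge> 0"
    and bound: "\<And>u v. norm (?f u v) \<le> C * (\<bar>c r u\<bar> * \<bar>d (r + int m) v\<bar>)"
    using Suc by auto
  have t: "- int M \<le> ?t" "?t < int M" using Suc.prems assms(1) by auto
  have \<phi>: "case_prod (\<phi> ?t) \<in> borel_measurable (\<mu> \<Otimes>\<^sub>M \<mu>)" using weight_measurable[OF t] .
  have int: "integrable \<mu> (\<lambda>z. \<bar>d (r + int m) z\<bar> * \<bar>c ?t z\<bar>)"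
    using Suc.prems assms(1) by (intro integrable_d_c) auto
  let ?I = "\<integral>z. \<bar>d (r + int m) z\<bar> * \<bar>c ?t z\<bar> \<partial>\<mu>"
  have "norm (iterated_weight \<mu> \<phi> r (Suc m) u v) \<le> (C * ?I) * (\<bar>c r u\<bar> * \<bar>d ?t v\<bar>)" for u v
  proof -
    let ?G = "\<lambda>z. (C * \<bar>c r u\<bar> * \<bar>d ?t v\<bar>) * (\<bar>d (r + int m) z\<bar> * \<bar>c ?t z\<bar>)"
    have le: "norm (?f u z * \<phi> ?t z v) \<le> ?G z" for z
    proof -
      have "norm (?f u z * \<phi> ?t z v) \<le> (C * (\<bar>c r u\<bar> * \<bar>d (r + int m) z\<bar>)) * (\<bar>c ?t z\<bar> * \<bar>d ?t v\<bar>)"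
        unfolding norm_mult
        by (rule mult_mono[OF bound weight_bound_abs[OF t]]) (use C in auto)
      then show ?thesis by (simp add: mult_ac)
    qed
    have "(\<lambda>z. ?f u z * \<phi> ?t z v) \<in> borel_measurable \<mu>"
      by (intro borel_measurable_times borel_measurable_section[OF f] borel_measurable_section[OF \<phi>])
        (auto simp: measurable_cong_sets[OF sets_mu refl])
    moreover have G: "integrable \<mu> ?G" using int by simp
    ultimately have "integrable \<mu> (\<lambda>z. ?f u z * \<phi> ?t z v)"
      using le by (intro integrable_dominated[OF G])
    then have "norm (\<integral>z. ?f u z * \<phi> ?t z v \<partial>\<mu>) \<le> (\<integral>z. ?G z \<partial>\<mu>)"
      using G le by (intro integral_norm_bound_integral) auto
    then show ?thesis
      unfolding integral_mult_right_zero by (simp add: convolution_def mult_ac)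
  qed
  moreover have "case_prod (iterated_weight \<mu> \<phi> r (Suc m)) \<in> borel_measurable (\<mu> \<Otimes>\<^sub>M \<mu>)"
  proof -
    have fst: "(\<lambda>p. fst (fst p)) \<in> borel_measurable ((\<mu> \<Otimes>\<^sub>M \<mu>) \<Otimes>\<^sub>M \<mu>)"
      and snd: "(\<lambda>p. snd (fst p)) \<in> borel_measurable ((\<mu> \<Otimes>\<^sub>M \<mu>) \<Otimes>\<^sub>M \<mu>)"
      and thd: "(\<lambda>p. snd p) \<in> borel_measurable ((\<mu> \<Otimes>\<^sub>M \<mu>) \<Otimes>\<^sub>M \<mu>)"
      by (simp_all add: measurable_cong_sets[OF refl sets_mu[symmetric]])
    have "(\<lambda>p. ?f (fst (fst p)) (snd p) * \<phi> ?t (snd p) (snd (fst p)))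
        \<in> borel_measurable ((\<mu> \<Otimes>\<^sub>M \<mu>) \<Otimes>\<^sub>M \<mu>)"
      by (intro borel_measurable_times borel_measurable_section[OF f] borel_measurable_section[OF \<phi>]
          fst snd thd)
    then have "(\<lambda>p. \<integral>z. ?f (fst p) z * \<phi> ?t z (snd p) \<partial>\<mu>) \<in> borel_measurable (\<mu> \<Otimes>\<^sub>M \<mu>)"
      by (intro borel_measurable_lebesgue_integral) (simp add: split_beta')
    then show ?thesis by (simp add: convolution_def split_beta')
  qed
  moreover have "C * ?I \<ge> 0" using C by (auto intro!: mult_nonneg_nonneg integral_nonneg)
  ultimately show ?case by blast
qed

section \<open>Transition weights between arbitrary times\<close>

lemma transition_measurable:
  assumes "- int M \<le> r" "s \<le> int M"
  shows "case_prod (transition \<mu> \<phi> r s) \<in> borel_measurable (\<mu> \<Otimes>\<^sub>M \<mu>)"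
  using iterated_weight_regular[of r "nat (s - r - 1)"] assms by (auto simp: transition_def)

text \<open>The last step towards time \<open>s\<close> is \<open>\<phi> (s - 1)\<close>, whence the
  index of \<open>d\<close>. For \<open>r \<ge> s\<close> the weight is zero and any constant
  works.\<close>

lemma transition_bound:
  assumes "- int M \<le> r" "s \<le> int M"
  shows "\<exists>C\<ge>0. \<forall>u v. norm (transition \<mu> \<phi> r s u v) \<le> C * (\<bar>c r u\<bar> * \<bar>d (s - 1) v\<bar>)"
  using iterated_weight_regular[of r "nat (s - r - 1)"] assms
  by (cases "r < s") (auto simp: transition_def)

lemma transition_Suc:
  assumes "r < s"
  shows "transition \<mu> \<phi> r (s + 1) x y = (\<integral>z. transition \<mu> \<phi> r s x z * \<phi> s z y \<partial>\<mu>)"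
proof -
  have "nat (s + 1 - r - 1) = Suc (nat (s - r - 1))" "r + int (Suc (nat (s - r - 1))) = s"
    using assms by auto
  then show ?thesis using assms by (simp add: transition_def convolution_def del: of_nat_Suc)
qed

lemma transition_step: "transition \<mu> \<phi> r (r + 1) = \<phi> r"
  by (simp add: transition_def)

lemma transition_eq_0: "s \<le> r \<Longrightarrow> transition \<mu> \<phi> r s x y = 0"
  by (simp add: transition_def)

lemma transition_measurable_section:
  assumes "- int M \<le> r" "s \<le> int M" "g \<in> borel_measurable N" "h \<in> borel_measurable N"
  shows "(\<lambda>z. transition \<mu> \<phi> r s (g z) (h z)) \<in> borel_measurable N"
  by (rule borel_measurable_section[OF transition_measurable[OF assms(1,2)] assms(3,4)])

text \<open>No order among \<open>r\<close>, \<open>s\<close>, \<open>t\<close> is imposed, because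
  the edges of arbitrary permutations occur; the product may be identically zero.\<close>

lemma integrable_transition_transition:
  assumes "- int M \<le> r" "- int M < s" "s < int M" "t \<le> int M"
  shows "integrable \<mu> (\<lambda>z. transition \<mu> \<phi> r s x z * transition \<mu> \<phi> s t z y)"
proof -
  obtain C where C: "C \<ge> 0" "\<And>u v. norm (transition \<mu> \<phi> r s u v) \<le> C * (\<bar>c r u\<bar> * \<bar>d (s - 1) v\<bar>)"
    using transition_bound[of r s] assms by auto
  obtain C' where C': "C' \<ge> 0" "\<And>u v. norm (transition \<mu> \<phi> s t u v) \<le> C' * (\<bar>c s u\<bar> * \<bar>d (t - 1) v\<bar>)"
    using transition_bound[of s t] assms by auto
  show ?thesis
  proof (rule integrable_dominated)
    show "integrable \<mu> (\<lambda>z. (C * C' * \<bar>c r x\<bar> * \<bar>d (t - 1) y\<bar>) * (\<bar>d (s - 1) z\<bar> * \<bar>c s z\<bar>))"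
      using integrable_d_c[of "s - 1" s] assms by simp
    show "(\<lambda>z. transition \<mu> \<phi> r s x z * transition \<mu> \<phi> s t z y) \<in> borel_measurable \<mu>"
      using assms by (intro borel_measurable_times transition_measurable_section)
        (auto simp: measurable_cong_sets[OF sets_mu refl])
    fix z
    have "norm (transition \<mu> \<phi> r s x z * transition \<mu> \<phi> s t z y) \<le>
        (C * (\<bar>c r x\<bar> * \<bar>d (s - 1) z\<bar>)) * (C' * (\<bar>c s z\<bar> * \<bar>d (t - 1) y\<bar>))"
      unfolding norm_mult by (rule mult_mono[OF C(2) C'(2)]) (use C in auto)
    then show "norm (transition \<mu> \<phi> r s x z * transition \<mu> \<phi> s t z y) \<le>
        (C * C' * \<bar>c r x\<bar> * \<bar>d (t - 1) y\<bar>) * (\<bar>d (s - 1) z\<bar> * \<bar>c s z\<bar>)"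
      by (simp add: mult_ac)
  qed
qed

text \<open>This is the Chapman-Kolmogorov identity. Convolutions are built up by appending steps on
  the right, so the induction is on \<open>t\<close>, and each step is an instance of associativity
  by Fubini.\<close>

lemma integral_transition_transition:
  assumes "- int M \<le> r" "r < s" "s < t" "t \<le> int M"
  shows "(\<integral>z. transition \<mu> \<phi> r s x z * transition \<mu> \<phi> s t z y \<partial>\<mu>) = transition \<mu> \<phi> r t x y"
proof -
  have "s + 1 \<le> t" using assms by simp
  then show ?thesis
    using assms(4)
  proof (induction t arbitrary: y rule: int_ge_induct)
    case base
    then show ?case using transition_Suc[OF assms(2)] by (simp add: transition_step)
  next
    case (step t)
    let ?T = "transition \<mu> \<phi>"
    obtain C where C: "C \<ge> 0" "\<And>u v. norm (?T r s u v) \<le> C * (\<bar>c r u\<bar> * \<bar>d (s - 1) v\<bar>)"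
      using transition_bound[of r s] assms step by auto
    obtain C' where C': "C' \<ge> 0" "\<And>u v. norm (?T s t u v) \<le> C' * (\<bar>c s u\<bar> * \<bar>d (t - 1) v\<bar>)"
      using transition_bound[of s t] assms step by auto
    have t: "- int M \<le> t" "t < int M" using assms step by auto
    let ?f = "\<lambda>z w. ?T r s x z * (?T s t z w * \<phi> t w y)"
    have meas: "case_prod ?f \<in> borel_measurable (\<mu> \<Otimes>\<^sub>M \<mu>)"
      unfolding split_beta'
      using assms step
      by (intro borel_measurable_times transition_measurable_section borel_measurable_section[OF weight_measurable[OF t]])
        (auto simp: measurable_cong_sets[OF refl sets_mu[symmetric]])
    \<comment> \<open>The majorant separates into a function of \<open>z\<close> and one of
      \<open>w\<close>, each integrable by \<open>integrable_d_c\<close>; this justifies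
      Fubini.\<close>
    have le: "norm (?f z w) \<le> (C * C' * \<bar>c r x\<bar> * \<bar>d t y\<bar>) *
        ((\<bar>d (s - 1) z\<bar> * \<bar>c s z\<bar>) * (\<bar>d (t - 1) w\<bar> * \<bar>c t w\<bar>))" for z w
    proof -
      have "norm (?f z w) \<le> (C * (\<bar>c r x\<bar> * \<bar>d (s - 1) z\<bar>)) *
          ((C' * (\<bar>c s z\<bar> * \<bar>d (t - 1) w\<bar>)) * (\<bar>c t w\<bar> * \<bar>d t y\<bar>))"
        unfolding norm_mult
        by (intro mult_mono C(2) C'(2) weight_bound_abs[OF t]) (use C C' in auto)
      then show ?thesis by (simp add: mult_ac)
    qed
    have i1: "integrable \<mu> (\<lambda>z. \<bar>d (s - 1) z\<bar> * \<bar>c s z\<bar>)"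
      and i2: "integrable \<mu> (\<lambda>w. \<bar>d (t - 1) w\<bar> * \<bar>c t w\<bar>)"
      using integrable_d_c[of "s - 1" s] integrable_d_c[of "t - 1" t] assms step t by auto
    have "integrable (\<mu> \<Otimes>\<^sub>M \<mu>) (\<lambda>p. (\<bar>d (s - 1) (fst p)\<bar> * \<bar>c s (fst p)\<bar>) *
        (\<bar>d (t - 1) (snd p)\<bar> * \<bar>c t (snd p)\<bar>))"
      using i1 i2 by (intro pair.Fubini_integrable)
        (auto simp: abs_mult intro!: borel_measurable_times
          measurable_compose[OF measurable_fst borel_measurable_integrable[OF i1]]
          measurable_compose[OF measurable_snd borel_measurable_integrable[OF i2]])
    then have "integrable (\<mu> \<Otimes>\<^sub>M \<mu>) (\<lambda>p. (C * C' * \<bar>c r x\<bar> * \<bar>d t y\<bar>) *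
        ((\<bar>d (s - 1) (fst p)\<bar> * \<bar>c s (fst p)\<bar>) * (\<bar>d (t - 1) (snd p)\<bar> * \<bar>c t (snd p)\<bar>)))"
      by (rule integrable_mult_right)
    then have int: "integrable (\<mu> \<Otimes>\<^sub>M \<mu>) (case_prod ?f)"
      by (rule integrable_dominated[OF _ meas]) (use le in \<open>auto simp del: norm_mult\<close>)
    have "(\<integral>z. ?T r s x z * ?T s (t + 1) z y \<partial>\<mu>) = (\<integral>z. (\<integral>w. ?f z w \<partial>\<mu>) \<partial>\<mu>)"
      using step by (subst transition_Suc) auto
    also have "\<dots> = (\<integral>w. (\<integral>z. ?f z w \<partial>\<mu>) \<partial>\<mu>)"
      by (rule pair.Fubini_integral[OF int, symmetric])
    also have "\<dots> = (\<integral>w. (\<integral>z. ?T r s x z * ?T s t z w \<partial>\<mu>) * \<phi> t w y \<partial>\<mu>)"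
      by (simp flip: mult.assoc)
    also have "\<dots> = ?T r (t + 1) x y"
      using step assms by (subst transition_Suc) auto
    finally show ?case .
  qed
qed

end

section \<open>Integrating out one point\<close>

text \<open>
  The label \<open>(int M, j)\<close> stands for \<open>a\<^sub>j\<close> at time \<open>-M\<close> when it labels a row, and for \<open>b\<^sub>j\<close> at time \<open>M\<close>
  when it labels a column, so that rows and columns share one index set; all other labels have the
  same meaning in both roles.
\<close>

definition row_time :: "nat \<Rightarrow> int \<times> nat \<Rightarrow> int" where
  "row_time M u = (if fst u = int M then - int M else fst u)"

definition terminal_index :: "nat \<Rightarrow> nat \<Rightarrow> (int \<times> nat) set" where
  "terminal_index n M = {int M} \<times> {..<n}"

definition path_entry ::
    "real measure \<Rightarrow> (int \<Rightarrow> real \<Rightarrow> real \<Rightarrow> complex) \<Rightarrow> nat \<Rightarrow> (nat \<Rightarrow> real) \<Rightarrow> (nat \<Rightarrow> real)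
      \<Rightarrow> (int \<times> nat \<Rightarrow> real) \<Rightarrow> int \<times> nat \<Rightarrow> int \<times> nat \<Rightarrow> complex" where
  "path_entry \<mu> \<phi> M a b w u v = transition \<mu> \<phi> (row_time M u) (fst v)
      (position M a b w (row_time M u) (snd u)) (position M a b w (fst v) (snd v))"

text \<open>This is the determinant D(P), with \<open>w\<close> supplying the positions of the
  points in \<open>P\<close>.\<close>

definition path_det ::
    "real measure \<Rightarrow> (int \<Rightarrow> real \<Rightarrow> real \<Rightarrow> complex) \<Rightarrow> nat \<Rightarrow> nat \<Rightarrow> (nat \<Rightarrow> real) \<Rightarrow> (nat \<Rightarrow> real)
      \<Rightarrow> (int \<times> nat \<Rightarrow> real) \<Rightarrow> (int \<times> nat) set \<Rightarrow> complex" where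
  "path_det \<mu> \<phi> n M a b w P = set_det (terminal_index n M \<union> P) (path_entry \<mu> \<phi> M a b w)"

lemma finite_terminal_index [simp]: "finite (terminal_index n M)"
  by (simp add: terminal_index_def)

lemma finite_config_index [simp]: "finite (config_index n M)"
  by (simp add: config_index_def)

lemma position_cong:
  assumes "r \<noteq> - int M \<Longrightarrow> r \<noteq> int M \<Longrightarrow> w (r, j) = w' (r, j)"
  shows "position M a b w r j = position M a b w' r j"
  using assms by (auto simp: position_def)

lemma path_entry_cong:
  assumes "u \<in> terminal_index n M \<union> P" "v \<in> terminal_index n M \<union> P"
    and "\<And>p. p \<in> P \<Longrightarrow> w p = w' p"
  shows "path_entry \<mu> \<phi> M a b w u v = path_entry \<mu> \<phi> M a b w' u v"
  unfolding path_entry_def using assms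
  by (cases u; cases v) (intro arg_cong2[of _ _ _ _ "transition \<mu> \<phi> (row_time M u) (fst v)"] position_cong;
      auto simp: terminal_index_def row_time_def split: if_splits)

lemma path_det_cong:
  assumes "\<And>p. p \<in> P \<Longrightarrow> w p = w' p"
  shows "path_det \<mu> \<phi> n M a b w P = path_det \<mu> \<phi> n M a b w' P"
  unfolding path_det_def using assms by (intro set_det_cong path_entry_cong) auto

text \<open>
  Edges go forward in time, so each one ending at time \<open>\<le> s\<close> has started before \<open>s\<close>. The number of
  crossings of time \<open>s\<close> is therefore the number of rows before \<open>s\<close> minus the number of columns up to
  \<open>s\<close>, whatever the permutation.
\<close>

lemma card_crossing_edges:
  assumes P: "P \<subseteq> config_index n M" and s: "- int M < s" "s < int M"
    and q: "q permutes (terminal_index n M \<union> P)"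
    and forward: "\<And>u. u \<in> terminal_index n M \<union> P \<Longrightarrow> row_time M u < fst (q u)"
  shows "card {u \<in> terminal_index n M \<union> P. row_time M u < s \<and> s < fst (q u)}
    + card {u \<in> P. fst u = s} = n"
proof -
  let ?E = "terminal_index n M"
  let ?Q = "?E \<union> P"
  have fin: "finite P" "finite ?Q" using finite_subset[OF P finite_config_index] by auto
  have disj: "?E \<inter> P = {}" using P by (auto simp: terminal_index_def config_index_def)
  \<comment> \<open>All \<open>n\<close> terminal labels count here, since as rows they have time
    \<open>-M\<close>; as columns they have time \<open>M\<close> and drop out of the count of
    columns up to \<open>s\<close>.\<close>
  have before: "{u \<in> ?Q. row_time M u < s} = ?E \<union> {u \<in> P. fst u < s}"
    using P s by (auto simp: terminal_index_def config_index_def row_time_def)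
  have 1: "card {u \<in> ?Q. row_time M u < s} = n + card {u \<in> P. fst u < s}"
    unfolding before using disj fin by (subst card_Un_disjoint) (auto simp: terminal_index_def)
  have split: "{u \<in> ?Q. row_time M u < s} =
      {u \<in> ?Q. row_time M u < s \<and> s < fst (q u)} \<union> {u \<in> ?Q. fst (q u) \<le> s}"
    using forward by force
  have 2: "card {u \<in> ?Q. row_time M u < s} =
      card {u \<in> ?Q. row_time M u < s \<and> s < fst (q u)} + card {u \<in> ?Q. fst (q u) \<le> s}"
    using fin by (subst split, subst card_Un_disjoint) auto
  have "q ` {u \<in> ?Q. fst (q u) \<le> s} = {v \<in> q ` ?Q. fst v \<le> s}"
    by auto
  also have "q ` ?Q = ?Q" by (rule permutes_image[OF q])
  finally have "card {u \<in> ?Q. fst (q u) \<le> s} = card {v \<in> ?Q. fst v \<le> s}"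
    using card_image[OF permutes_inj_on[OF q, of "{u \<in> ?Q. fst (q u) \<le> s}"]] by (simp only:)
  also have "{v \<in> ?Q. fst v \<le> s} = {u \<in> P. fst u < s} \<union> {u \<in> P. fst u = s}"
    using s by (auto simp: terminal_index_def)
  also have "card \<dots> = card {u \<in> P. fst u < s} + card {u \<in> P. fst u = s}"
    using fin by (subst card_Un_disjoint) auto
  finally show ?thesis using 1 2 by simp
qed

context transition_weights
begin

lemma row_time_bounds:
  assumes "P \<subseteq> config_index n M" "u \<in> terminal_index n M \<union> P"
  shows "- int M \<le> row_time M u" "fst u \<le> int M"
  using assms by (auto simp: row_time_def terminal_index_def config_index_def)

text \<open>The minus sign is the one in \<open>set_det_insert\<close>. The other factor is the
  number of crossing edges, which \<open>card_crossing_edges\<close> shows to be the same for all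
  permutations that contribute.\<close>

lemma integral_path_det_point:
  assumes P: "P \<subseteq> config_index n M" and z: "z \<in> config_index n M" "z \<notin> P"
  shows "(\<integral>y. path_det \<mu> \<phi> n M a b (w(z := y)) (insert z P) \<partial>\<mu>) =
    - (of_nat n - of_nat (card {u \<in> P. fst u = fst z})) * path_det \<mu> \<phi> n M a b w P"
proof -
  let ?Q = "terminal_index n M \<union> P" and ?s = "fst z" and ?T = "transition \<mu> \<phi>"
  let ?g = "path_entry \<mu> \<phi> M a b"
  have fin: "finite ?Q" using finite_subset[OF P finite_config_index] by auto
  have zQ: "z \<notin> ?Q" using z by (auto simp: terminal_index_def config_index_def)
  have s: "- int M < ?s" "?s < int M" and rz: "row_time M z = ?s"
    using z by (auto simp: config_index_def row_time_def)
  have unaffected: "?g (w(z := y)) u v = ?g w u v" if "u \<in> ?Q" "v \<in> ?Q" for u v y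
    using that z(2) by (intro path_entry_cong[of u n M P v]) auto
  have in_z: "?g (w(z := y)) u z = ?T (row_time M u) ?s (position M a b w (row_time M u) (snd u)) y"
    and out_z: "?g (w(z := y)) z u = ?T ?s (fst u) y (position M a b w (fst u) (snd u))"
    if "u \<in> ?Q" for u y
  proof -
    have "position M a b (w(z := y)) ?s (snd z) = y"
      using s by (simp add: position_def)
    moreover have "position M a b (w(z := y)) r (snd u) = position M a b w r (snd u)"
      if "r = fst u \<or> r = row_time M u" for r
      using that \<open>u \<in> ?Q\<close> zQ by (intro position_cong) (auto simp: row_time_def split: if_splits)
    ultimately show "?g (w(z := y)) u z = ?T (row_time M u) ?s (position M a b w (row_time M u) (snd u)) y"
      "?g (w(z := y)) z u = ?T ?s (fst u) y (position M a b w (fst u) (snd u))"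
      by (simp_all add: path_entry_def rz)
  qed
  \<comment> \<open>\<open>?in\<close> and \<open>?out\<close> are the two halves of a split edge as
    functions of the position \<open>y\<close> of \<open>z\<close>; \<open>?rest\<close> collects
    the edges left intact and does not depend on \<open>y\<close>.\<close>
  let ?in = "\<lambda>u y. ?T (row_time M u) ?s (position M a b w (row_time M u) (snd u)) y"
  let ?out = "\<lambda>u y. ?T ?s (fst u) y (position M a b w (fst u) (snd u))"
  let ?rest = "\<lambda>q u. \<Prod>v\<in>?Q - {u}. ?g w v (q v)"
  have expand: "path_det \<mu> \<phi> n M a b (w(z := y)) (insert z P) =
      - (\<Sum>q | q permutes ?Q. of_int (sign q) * (\<Sum>u\<in>?Q. ?in u y * ?out (q u) y * ?rest q u))" for y
  proof -
    have "path_det \<mu> \<phi> n M a b (w(z := y)) (insert z P) = set_det (insert z ?Q) (?g (w(z := y)))"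
      by (simp add: path_det_def)
    also have "\<dots> = - (\<Sum>q | q permutes ?Q. of_int (sign q) *
        (\<Sum>u\<in>?Q. ?g (w(z := y)) u z * ?g (w(z := y)) z (q u) * (\<Prod>v\<in>?Q - {u}. ?g (w(z := y)) v (q v))))"
      by (rule set_det_insert[OF fin zQ]) (simp add: path_entry_def rz transition_eq_0)
    also have "\<dots> = - (\<Sum>q | q permutes ?Q. of_int (sign q) * (\<Sum>u\<in>?Q. ?in u y * ?out (q u) y * ?rest q u))"
    proof -
      have "?g (w(z := y)) u z * ?g (w(z := y)) z (q u) * (\<Prod>v\<in>?Q - {u}. ?g (w(z := y)) v (q v)) =
          ?in u y * ?out (q u) y * ?rest q u" if "q permutes ?Q" "u \<in> ?Q" for q u
      proof -
        have "q v \<in> ?Q" if "v \<in> ?Q" for v using that \<open>q permutes ?Q\<close> by (simp only: permutes_in_image)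
        then show ?thesis
          using \<open>u \<in> ?Q\<close> by (intro arg_cong2[of _ _ _ _ "(*)"] in_z out_z prod.cong unaffected) auto
      qed
      then show ?thesis by simp
    qed
    finally show ?thesis .
  qed
  have int: "integrable \<mu> (\<lambda>y. ?in u y * ?out (q u) y)" if "q permutes ?Q" "u \<in> ?Q" for q u
  proof -
    have "q u \<in> ?Q" using that by (simp only: permutes_in_image)
    then show ?thesis
      using that s row_time_bounds[OF P] by (intro integrable_transition_transition) auto
  qed
  \<comment> \<open>An edge that does not cross time \<open>?s\<close> has a half that fails to go
    forward in time, so the integrand vanishes.\<close>
  have integral_edge: "(\<integral>y. ?in u y * ?out (q u) y \<partial>\<mu>) =
      (if row_time M u < ?s \<and> ?s < fst (q u) then ?g w u (q u) else 0)" if "q permutes ?Q" "u \<in> ?Q" for q u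
  proof -
    have "q u \<in> ?Q" using that by (simp only: permutes_in_image)
    then show ?thesis
      using that row_time_bounds[OF P]
      by (auto simp: integral_transition_transition path_entry_def transition_eq_0)
  qed
  have count: "(\<Sum>u\<in>?Q. (if row_time M u < ?s \<and> ?s < fst (q u) then ?g w u (q u) else 0) * ?rest q u) =
      (of_nat n - of_nat (card {u \<in> P. fst u = ?s})) * (\<Prod>u\<in>?Q. ?g w u (q u))" (is "?l = ?r")
    if q: "q permutes ?Q" for q
  proof -
    have "?l = (\<Sum>u\<in>?Q. if row_time M u < ?s \<and> ?s < fst (q u) then (\<Prod>u\<in>?Q. ?g w u (q u)) else 0)"
    proof (intro sum.cong refl)
      fix u assume "u \<in> ?Q"
      from prod.remove[OF fin this, of "\<lambda>u. ?g w u (q u)"]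
      show "(if row_time M u < ?s \<and> ?s < fst (q u) then ?g w u (q u) else 0) * ?rest q u =
          (if row_time M u < ?s \<and> ?s < fst (q u) then (\<Prod>u\<in>?Q. ?g w u (q u)) else 0)"
        by (simp only: if_distrib[of "\<lambda>t. t * _"] mult_zero_left split: if_split)
    qed
    also have "\<dots> = of_nat (card {u \<in> ?Q. row_time M u < ?s \<and> ?s < fst (q u)}) * (\<Prod>u\<in>?Q. ?g w u (q u))"
      using fin by (simp add: sum.If_cases Int_def)
    also have "\<dots> = ?r"
    \<comment> \<open>If some edge fails to go forward, the whole product is zero and its
      coefficient is immaterial; otherwise the count of crossing edges applies.\<close>
    proof (cases "\<forall>u\<in>?Q. row_time M u < fst (q u)")
      case True
      have "card {u \<in> ?Q. row_time M u < ?s \<and> ?s < fst (q u)} + card {u \<in> P. fst u = ?s} = n"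
        by (rule card_crossing_edges[OF P s q]) (use True in blast)
      then have "of_nat n = (of_nat (card {u \<in> ?Q. row_time M u < ?s \<and> ?s < fst (q u)})
          + of_nat (card {u \<in> P. fst u = ?s}) :: complex)"
        by (simp flip: of_nat_add)
      then show ?thesis by simp
    next
      case False
      then obtain u where "u \<in> ?Q" "fst (q u) \<le> row_time M u" by force
      then have "(\<Prod>u\<in>?Q. ?g w u (q u)) = 0"
        using fin by (intro prod_zero bexI[of _ u]) (simp_all add: path_entry_def transition_eq_0)
      then show ?thesis by simp
    qed
    finally show ?thesis .
  qed
  have inner: "integrable \<mu> (\<lambda>y. \<Sum>u\<in>?Q. ?in u y * ?out (q u) y * ?rest q u)"
    "(\<integral>y. (\<Sum>u\<in>?Q. ?in u y * ?out (q u) y * ?rest q u) \<partial>\<mu>) =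
      (of_nat n - of_nat (card {u \<in> P. fst u = ?s})) * (\<Prod>u\<in>?Q. ?g w u (q u))"
    if q: "q \<in> {q. q permutes ?Q}" for q
  proof -
    have q: "q permutes ?Q" using that by simp
    have *: "integrable \<mu> (\<lambda>y. ?in u y * ?out (q u) y * ?rest q u)" if "u \<in> ?Q" for u
      by (rule integrable_mult_left[OF int[OF q that]])
    then show "integrable \<mu> (\<lambda>y. \<Sum>u\<in>?Q. ?in u y * ?out (q u) y * ?rest q u)"
      by (rule integrable_sum)
    have "(\<integral>y. (\<Sum>u\<in>?Q. ?in u y * ?out (q u) y * ?rest q u) \<partial>\<mu>) =
        (\<Sum>u\<in>?Q. \<integral>y. ?in u y * ?out (q u) y * ?rest q u \<partial>\<mu>)"
      using * by (rule Bochner_Integration.integral_sum)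
    also have "\<dots> = (\<Sum>u\<in>?Q. (if row_time M u < ?s \<and> ?s < fst (q u) then ?g w u (q u) else 0) * ?rest q u)"
      by (intro sum.cong refl) (simp only: integral_mult_left_zero integral_edge[OF q])
    finally show "(\<integral>y. (\<Sum>u\<in>?Q. ?in u y * ?out (q u) y * ?rest q u) \<partial>\<mu>) =
        (of_nat n - of_nat (card {u \<in> P. fst u = ?s})) * (\<Prod>u\<in>?Q. ?g w u (q u))"
      by (simp only: count[OF q])
  qed
  have "(\<integral>y. path_det \<mu> \<phi> n M a b (w(z := y)) (insert z P) \<partial>\<mu>) =
      - (\<Sum>q | q permutes ?Q. \<integral>y. of_int (sign q) * (\<Sum>u\<in>?Q. ?in u y * ?out (q u) y * ?rest q u) \<partial>\<mu>)"
    unfolding expand integral_minus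
    by (rule arg_cong[of _ _ uminus], rule Bochner_Integration.integral_sum)
       (rule integrable_mult_right[OF inner(1)])
  also have "\<dots> = - (\<Sum>q | q permutes ?Q. of_int (sign q) *
      ((of_nat n - of_nat (card {u \<in> P. fst u = ?s})) * (\<Prod>u\<in>?Q. ?g w u (q u))))"
    by (intro arg_cong[of _ _ uminus] sum.cong refl) (simp only: integral_mult_right_zero inner(2))
  also have "\<dots> = - (of_nat n - of_nat (card {u \<in> P. fst u = ?s})) * path_det \<mu> \<phi> n M a b w P"
    unfolding path_det_def set_det_def mult_minus_left
    by (rule arg_cong[of _ _ uminus], subst sum_distrib_left, intro sum.cong refl mult.left_commute)
  finally show ?thesis .
qed

end

section \<open>Integrating out several points\<close>

context transition_weights
begin

text \<open>As a function of \<open>y\<close> the position is a single coordinate when the label is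
  free and constant otherwise; the constant may be read off at any argument, here
  \<open>undefined\<close> everywhere.\<close>

lemma position_component_measurable:
  "(\<lambda>y. position M a b (merge P F (x, y)) r j) \<in> borel_measurable (\<Pi>\<^sub>M p\<in>F. \<mu>)"
proof (cases "r \<noteq> - int M \<and> r \<noteq> int M \<and> (r, j) \<in> F \<and> (r, j) \<notin> P")
  case True
  then have "(\<lambda>y. y (r, j)) \<in> (\<Pi>\<^sub>M p\<in>F. \<mu>) \<rightarrow>\<^sub>M \<mu>"
    by (intro measurable_component_singleton) auto
  then show ?thesis
    using True by (simp add: position_def merge_def measurable_cong_sets[OF refl sets_mu])
next
  case False
  have "(\<lambda>y. position M a b (merge P F (x, y)) r j) =
      (\<lambda>_. position M a b (merge P F (x, \<lambda>_. undefined)) r j)"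
    using False by (intro ext position_cong) (auto simp: merge_def)
  then show ?thesis by simp
qed

lemma path_entry_measurable:
  assumes "- int M \<le> row_time M u" "fst v \<le> int M"
  shows "(\<lambda>y. path_entry \<mu> \<phi> M a b (merge P F (x, y)) u v) \<in> borel_measurable (\<Pi>\<^sub>M p\<in>F. \<mu>)"
  unfolding path_entry_def
  by (intro transition_measurable_section assms position_component_measurable)

text \<open>The constants are chosen at once for all pairs of labels, so that they can be multiplied
  along a permutation.\<close>

lemma path_entry_bound:
  obtains C where "\<And>u v. - int M \<le> row_time M u \<Longrightarrow> fst v \<le> int M \<Longrightarrow> 0 \<le> C u v \<and>
    (\<forall>w. norm (path_entry \<mu> \<phi> M a b w u v) \<le>
      C u v * (\<bar>c (row_time M u) (position M a b w (row_time M u) (snd u))\<bar> *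
        \<bar>d (fst v - 1) (position M a b w (fst v) (snd v))\<bar>))"
proof -
  have "\<exists>C. \<forall>r s. - int M \<le> r \<longrightarrow> s \<le> int M \<longrightarrow> 0 \<le> C r s \<and>
      (\<forall>x y. norm (transition \<mu> \<phi> r s x y) \<le> C r s * (\<bar>c r x\<bar> * \<bar>d (s - 1) y\<bar>))"
    using transition_bound by metis
  then obtain C where C: "\<And>r s. - int M \<le> r \<Longrightarrow> s \<le> int M \<Longrightarrow> 0 \<le> C r s \<and>
      (\<forall>x y. norm (transition \<mu> \<phi> r s x y) \<le> C r s * (\<bar>c r x\<bar> * \<bar>d (s - 1) y\<bar>))"
    by blast
  show ?thesis
    by (rule that[of "\<lambda>u v. C (row_time M u) (fst v)"]) (use C in \<open>auto simp: path_entry_def\<close>)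
qed

text \<open>Along a permutation each label occurs once as a row, giving a factor \<open>c\<close>,
  and once as a column, giving a factor \<open>d\<close>. Regrouped by labels, the bound is a
  constant from the terminal and fixed labels times a product of integrable functions, one for each
  coordinate of \<open>y\<close>.\<close>

lemma integrable_path_det:
  assumes P: "P \<subseteq> config_index n M" and F: "F \<subseteq> config_index n M" and disj: "P \<inter> F = {}"
  shows "integrable (\<Pi>\<^sub>M p\<in>F. \<mu>) (\<lambda>y. path_det \<mu> \<phi> n M a b (merge P F (x, y)) (P \<union> F))"
proof -
  let ?Q = "terminal_index n M \<union> (P \<union> F)" and ?w = "\<lambda>y. merge P F (x, y)"
  let ?N = "\<Pi>\<^sub>M p\<in>F. \<mu>"
  have PF: "P \<union> F \<subseteq> config_index n M" using P F by auto
  note bounds = row_time_bounds[OF PF]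
  have fin: "finite P" "finite F" "finite ?Q"
    using finite_subset[OF _ finite_config_index] P F by auto
  have disjF: "(terminal_index n M \<union> P) \<inter> F = {}" and Q: "?Q = (terminal_index n M \<union> P) \<union> F"
    using disj F by (auto simp: terminal_index_def config_index_def)
  obtain C where C: "\<And>u v. - int M \<le> row_time M u \<Longrightarrow> fst v \<le> int M \<Longrightarrow> 0 \<le> C u v \<and>
    (\<forall>w. norm (path_entry \<mu> \<phi> M a b w u v) \<le>
      C u v * (\<bar>c (row_time M u) (position M a b w (row_time M u) (snd u))\<bar> *
        \<bar>d (fst v - 1) (position M a b w (fst v) (snd v))\<bar>))"
    using path_entry_bound by metis
  let ?c = "\<lambda>w u. \<bar>c (row_time M u) (position M a b w (row_time M u) (snd u))\<bar>"
  let ?d = "\<lambda>w u. \<bar>d (fst u - 1) (position M a b w (fst u) (snd u))\<bar>"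
  have prod_integrable: "integrable ?N (\<lambda>y. \<Prod>u\<in>?Q. path_entry \<mu> \<phi> M a b (?w y) u (q u))"
    if q: "q permutes ?Q" for q
  proof -
    have qQ: "q u \<in> ?Q" if "u \<in> ?Q" for u using q that by (simp only: permutes_in_image)
    let ?K = "(\<Prod>u\<in>?Q. C u (q u)) * (\<Prod>u\<in>terminal_index n M \<union> P. ?c x u * ?d x u)"
    show ?thesis
    proof (rule integrable_dominated)
      have "integrable ?N (\<lambda>y. \<Prod>u\<in>F. \<bar>d (fst u - 1) (y u)\<bar> * \<bar>c (fst u) (y u)\<bar>)"
        using F by (intro product.product_integrable_prod fin integrable_d_c) (auto simp: config_index_def)
      then show "integrable ?N (\<lambda>y. ?K * (\<Prod>u\<in>F. \<bar>d (fst u - 1) (y u)\<bar> * \<bar>c (fst u) (y u)\<bar>))"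
        by (rule integrable_mult_right)
      show "(\<lambda>y. \<Prod>u\<in>?Q. path_entry \<mu> \<phi> M a b (?w y) u (q u)) \<in> borel_measurable ?N"
        using bounds qQ by (intro borel_measurable_prod path_entry_measurable) blast+
      fix y
      have "norm (\<Prod>u\<in>?Q. path_entry \<mu> \<phi> M a b (?w y) u (q u)) \<le>
          (\<Prod>u\<in>?Q. C u (q u) * (?c (?w y) u * ?d (?w y) (q u)))"
        unfolding prod_norm[symmetric]
      proof (intro prod_mono conjI norm_ge_zero)
        fix u assume "u \<in> ?Q"
        then show "norm (path_entry \<mu> \<phi> M a b (?w y) u (q u)) \<le> C u (q u) * (?c (?w y) u * ?d (?w y) (q u))"
          using C[OF bounds(1)[of u] bounds(2)[of "q u"]] qQ[of u] by simp
      qed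
      also have "\<dots> = (\<Prod>u\<in>?Q. C u (q u)) * ((\<Prod>u\<in>?Q. ?c (?w y) u) * (\<Prod>u\<in>?Q. ?d (?w y) (q u)))"
        by (simp only: prod.distrib)
      also have "(\<Prod>u\<in>?Q. ?d (?w y) (q u)) = (\<Prod>u\<in>?Q. ?d (?w y) u)"
        by (rule prod.reindex_bij_betw[OF permutes_imp_bij[OF q]])
      also have "(\<Prod>u\<in>?Q. ?c (?w y) u) * (\<Prod>u\<in>?Q. ?d (?w y) u) = (\<Prod>u\<in>?Q. ?c (?w y) u * ?d (?w y) u)"
        by (simp only: prod.distrib)
      also have "\<dots> = (\<Prod>u\<in>terminal_index n M \<union> P. ?c (?w y) u * ?d (?w y) u) *
          (\<Prod>u\<in>F. ?c (?w y) u * ?d (?w y) u)"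
        unfolding Q using fin disjF by (intro prod.union_disjoint) auto
      also have "(\<Prod>u\<in>F. ?c (?w y) u * ?d (?w y) u) =
          (\<Prod>u\<in>F. \<bar>d (fst u - 1) (y u)\<bar> * \<bar>c (fst u) (y u)\<bar>)"
      proof (intro prod.cong refl)
        fix u assume u: "u \<in> F"
        then have "row_time M u = fst u" "position M a b (?w y) (fst u) (snd u) = y u"
          using F disj by (auto simp: config_index_def row_time_def position_def)
        then show "?c (?w y) u * ?d (?w y) u = \<bar>d (fst u - 1) (y u)\<bar> * \<bar>c (fst u) (y u)\<bar>"
          by simp
      qed
      also have "(\<Prod>u\<in>terminal_index n M \<union> P. ?c (?w y) u * ?d (?w y) u) =
          (\<Prod>u\<in>terminal_index n M \<union> P. ?c x u * ?d x u)"
      proof (intro prod.cong refl)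
        fix u assume u: "u \<in> terminal_index n M \<union> P"
        then have "position M a b (?w y) r (snd u) = position M a b x r (snd u)"
          if "r = fst u \<or> r = row_time M u" for r
          using that by (intro position_cong)
            (auto simp: merge_def row_time_def terminal_index_def split: if_splits)
        then show "?c (?w y) u * ?d (?w y) u = ?c x u * ?d x u"
          by simp
      qed
      finally show "norm (\<Prod>u\<in>?Q. path_entry \<mu> \<phi> M a b (?w y) u (q u)) \<le>
          ?K * (\<Prod>u\<in>F. \<bar>d (fst u - 1) (y u)\<bar> * \<bar>c (fst u) (y u)\<bar>)"
        by (simp only: mult.assoc)
    qed
  qed
  show ?thesis
    unfolding path_det_def set_det_def
    by (intro integrable_sum integrable_mult_right) (use prod_integrable in auto)
qed

text \<open>The points of \<open>F\<close> are integrated out one at a time. The factor with index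
  \<open>i\<close> belongs to the point at time \<open>r\<close> that is removed while exactly
  \<open>i\<close> other points of \<open>F\<close> at that time remain.\<close>

lemma integral_path_det:
  assumes P: "P \<subseteq> config_index n M" and F: "F \<subseteq> config_index n M" and disj: "P \<inter> F = {}"
  shows "(\<integral>y. path_det \<mu> \<phi> n M a b (merge P F (x, y)) (P \<union> F) \<partial>(\<Pi>\<^sub>M p\<in>F. \<mu>)) =
    (\<Prod>r\<in>{- int M <..< int M}. \<Prod>i<card {u \<in> F. fst u = r}.
      - (of_nat n - of_nat (card {u \<in> P. fst u = r}) - of_nat i)) * path_det \<mu> \<phi> n M a b x P"
proof -
  have "finite F" using finite_subset[OF F finite_config_index] .
  then show ?thesis
    using F disj
  proof (induction F)
    case empty
    have "path_det \<mu> \<phi> n M a b (merge P {} (x, \<lambda>_. undefined)) P = path_det \<mu> \<phi> n M a b x P"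
      by (intro path_det_cong) (simp add: merge_def)
    then show ?case by (simp add: PiM_empty lebesgue_integral_count_space_finite)
  next
    case (insert z F)
    have z: "z \<in> config_index n M" "z \<notin> P \<union> F" and F: "F \<subseteq> config_index n M" "P \<inter> F = {}"
      using insert.prems insert.hyps by auto
    let ?s = "fst z" and ?T = "{- int M <..< int M}"
    let ?D = "path_det \<mu> \<phi> n M a b"
    let ?m = "\<lambda>A. card {u \<in> A. fst u = ?s}"
    let ?h = "\<lambda>r i. - (of_nat n - of_nat (card {u \<in> P. fst u = r}) - of_nat i :: complex)"
    have s: "?s \<in> ?T" using z by (auto simp: config_index_def)
    have fin: "finite P" "finite F" using finite_subset[OF _ finite_config_index] P F by auto
    have merge_upd: "merge P (insert z F) (x, y(z := t)) = (merge P F (x, y))(z := t)" for y t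
      using z by (auto simp: merge_def)
    have "(\<integral>y. ?D (merge P (insert z F) (x, y)) (P \<union> insert z F) \<partial>(\<Pi>\<^sub>M p\<in>insert z F. \<mu>)) =
        (\<integral>y. (\<integral>t. ?D (merge P (insert z F) (x, y(z := t))) (P \<union> insert z F) \<partial>\<mu>) \<partial>(\<Pi>\<^sub>M p\<in>F. \<mu>))"
      using insert.hyps insert.prems by (intro product.product_integral_insert integrable_path_det P) auto
    also have "\<dots> = (\<integral>y. - (of_nat n - of_nat (?m (P \<union> F))) * ?D (merge P F (x, y)) (P \<union> F) \<partial>(\<Pi>\<^sub>M p\<in>F. \<mu>))"
      unfolding merge_upd Un_insert_right
      using P F z by (subst integral_path_det_point) auto
    also have "\<dots> = - (of_nat n - of_nat (?m (P \<union> F))) *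
        ((\<Prod>r\<in>?T. \<Prod>i<card {u \<in> F. fst u = r}. ?h r i) * ?D x P)"
      by (simp only: integral_mult_right_zero insert.IH[OF F])
    \<comment> \<open>The new point is integrated first, with all of \<open>F\<close> still present,
      so it supplies the factor of highest index at its time.\<close>
    also have "- (of_nat n - of_nat (?m (P \<union> F))) = ?h ?s (?m F)"
    proof -
      have "{u \<in> P \<union> F. fst u = ?s} = {u \<in> P. fst u = ?s} \<union> {u \<in> F. fst u = ?s}" by auto
      then have "?m (P \<union> F) = ?m P + ?m F"
        using fin F(2) by (simp only:) (subst card_Un_disjoint; auto)
      then show ?thesis by simp
    qed
    also have "?h ?s (?m F) * ((\<Prod>r\<in>?T. \<Prod>i<card {u \<in> F. fst u = r}. ?h r i) * ?D x P) =
        (\<Prod>r\<in>?T. \<Prod>i<card {u \<in> insert z F. fst u = r}. ?h r i) * ?D x P"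
    proof -
      have "{u \<in> insert z F. fst u = ?s} = insert z {u \<in> F. fst u = ?s}" by auto
      then have 1: "?m (insert z F) = Suc (?m F)" using fin insert.hyps by simp
      have 2: "{u \<in> insert z F. fst u = r} = {u \<in> F. fst u = r}" if "r \<noteq> ?s" for r using that by auto
      have "(\<Prod>r\<in>?T. \<Prod>i<card {u \<in> insert z F. fst u = r}. ?h r i) =
          (\<Prod>i<?m (insert z F). ?h ?s i) *
          (\<Prod>r\<in>?T - {?s}. \<Prod>i<card {u \<in> insert z F. fst u = r}. ?h r i)"
        using s by (intro prod.remove) auto
      also have "(\<Prod>r\<in>?T - {?s}. \<Prod>i<card {u \<in> insert z F. fst u = r}. ?h r i) =
          (\<Prod>r\<in>?T - {?s}. \<Prod>i<card {u \<in> F. fst u = r}. ?h r i)"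
        by (rule prod.cong[OF refl], subst 2) auto
      moreover have "(\<Prod>r\<in>?T. \<Prod>i<card {u \<in> F. fst u = r}. ?h r i) =
          (\<Prod>i<?m F. ?h ?s i) * (\<Prod>r\<in>?T - {?s}. \<Prod>i<card {u \<in> F. fst u = r}. ?h r i)"
        using s by (subst prod.remove[of _ ?s]) auto
      ultimately show ?thesis by (simp only: 1 prod.lessThan_Suc mult_ac)
    qed
    finally show ?case .
  qed
qed

end

section \<open>The weight and the kernel as determinants\<close>

text \<open>The cyclic shift of the columns by one time step: it faces rows at time \<open>r\<close>
  with columns at time \<open>r + 1\<close>. A terminal label, being a row at time
  \<open>-M\<close>, moves to \<open>-M + 1\<close>, and a label at time \<open>M - 1\<close>
  becomes terminal.\<close>

definition advance :: "nat \<Rightarrow> nat \<Rightarrow> int \<times> nat \<Rightarrow> int \<times> nat" where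
  "advance n M u =
    (if u \<in> terminal_index n M \<union> config_index n M then (row_time M u + 1, snd u) else u)"

lemma advance_permutes:
  assumes "M \<ge> 1"
  shows "advance n M permutes (terminal_index n M \<union> config_index n M)"
proof (rule bij_imp_permutes)
  let ?back = "\<lambda>u :: int \<times> nat. (if fst u = - int M + 1 then int M else fst u - 1, snd u)"
  show "bij_betw (advance n M) (terminal_index n M \<union> config_index n M)
      (terminal_index n M \<union> config_index n M)"
    using assms
    by (intro bij_betw_byWitness[where f' = ?back])
       (auto simp: advance_def row_time_def terminal_index_def config_index_def split: if_splits)
  show "advance n M u = u" if "u \<notin> terminal_index n M \<union> config_index n M" for u
    using that by (simp add: advance_def)
qed

lemma distinct_concat_map_Pair:
  "distinct rs \<Longrightarrow> distinct (concat (map (\<lambda>r. map (Pair r) [0..<k r]) rs))"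
  by (induction rs) (auto simp: distinct_map inj_on_def)

lemma distinct_block_labels: "distinct (block_labels M k)"
  using distinct_concat_map_Pair[of "[- int M + 1..int M - 1]" k] by (simp add: block_labels_def)

lemma set_block_labels: "set (block_labels M k) = fixed_index M k"
proof -
  have "{- int M + 1..int M - 1} = {- int M<..<int M}" by auto
  then show ?thesis
    by (simp only: block_labels_def fixed_index_def set_concat set_map set_upto) force
qed

context transition_weights
begin

text \<open>After the shift the matrix is block triangular with respect to \<open>row_time\<close>,
  and its diagonal blocks are the one-step matrices.\<close>

lemma path_weight_eq_path_det:
  assumes M: "M \<ge> 1"
  shows "path_weight \<phi> n M a b w =
    of_int (sign (advance n M)) * path_det \<mu> \<phi> n M a b w (config_index n M)"
proof -
  let ?L = "terminal_index n M \<union> config_index n M"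
  let ?h = "\<lambda>u v. path_entry \<mu> \<phi> M a b w u (advance n M v)"
  have "path_det \<mu> \<phi> n M a b w (config_index n M) = of_int (sign (advance n M)) * set_det ?L ?h"
    unfolding path_det_def by (rule set_det_compose[OF advance_permutes[OF M]]) simp
  then have "of_int (sign (advance n M)) * path_det \<mu> \<phi> n M a b w (config_index n M) = set_det ?L ?h"
    by (simp flip: mult.assoc of_int_mult)
  also have "\<dots> = (\<Prod>s\<in>{- int M..<int M}. set_det {u \<in> ?L. row_time M u = s} ?h)"
  proof (rule set_det_block_triangular)
    show "row_time M ` ?L \<subseteq> {- int M..<int M}"
      using M by (auto simp: row_time_def terminal_index_def config_index_def)
    \<comment> \<open>The shifted column has time \<open>row_time M v + 1\<close>, which is at most
      \<open>row_time M u\<close>, so the transition weight is zero by convention.\<close>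
    show "?h u v = 0" if "v \<in> ?L" "row_time M v < row_time M u" for u v
      using that by (simp add: advance_def path_entry_def transition_eq_0)
  qed auto
  also have "\<dots> = path_weight \<phi> n M a b w"
    unfolding path_weight_def
  proof (intro prod.cong refl)
    fix s assume s: "s \<in> {- int M..<int M}"
    \<comment> \<open>The rows at the initial time carry the label time
      \<open>int M\<close>.\<close>
    define s' where "s' = (if s = - int M then int M else s)"
    have s': "row_time M (s', i) = s" "i < n \<Longrightarrow> (s', i) \<in> ?L" for i
      using s by (auto simp: s'_def row_time_def terminal_index_def config_index_def)
    let ?xs = "map (Pair s') [0..<n]"
    have "{u \<in> ?L. row_time M u = s} = set ?xs"
      using s M by (auto simp: s'_def row_time_def terminal_index_def config_index_def split: if_splits)
    then have "set_det {u \<in> ?L. row_time M u = s} ?h =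
        Determinant.det (mat n n (\<lambda>(i, j). ?h (?xs ! i) (?xs ! j)))"
      using set_det_conv_det[of ?xs ?h] by (simp add: distinct_map inj_on_def)
    also have "mat n n (\<lambda>(i, j). ?h (?xs ! i) (?xs ! j)) =
        mat n n (\<lambda>(i, j). \<phi> s (position M a b w s i) (position M a b w (s + 1) j))"
      using s' by (intro cong_mat refl) (auto simp: advance_def path_entry_def transition_step)
    finally show "set_det {u \<in> ?L. row_time M u = s} ?h = Determinant.det \<dots>" .
  qed
  finally show ?thesis ..
qed

lemma path_det_empty:
  assumes "M \<ge> 1"
  shows "path_det \<mu> \<phi> n M a b w {} = Determinant.det (end_matrix \<mu> \<phi> n M a b)"
proof -
  let ?xs = "map (Pair (int M)) [0..<n]"
  have "terminal_index n M = set ?xs" by (auto simp: terminal_index_def)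
  then have "path_det \<mu> \<phi> n M a b w {} =
      Determinant.det (mat n n (\<lambda>(i, j). path_entry \<mu> \<phi> M a b w (?xs ! i) (?xs ! j)))"
    using set_det_conv_det[of ?xs "path_entry \<mu> \<phi> M a b w"]
    by (simp add: path_det_def distinct_map inj_on_def)
  also have "mat n n (\<lambda>(i, j). path_entry \<mu> \<phi> M a b w (?xs ! i) (?xs ! j)) = end_matrix \<mu> \<phi> n M a b"
    unfolding end_matrix_def using assms
    by (intro cong_mat refl) (auto simp: path_entry_def row_time_def position_def)
  finally show ?thesis .
qed

text \<open>With the terminal labels listed first, the upper left block is the end matrix, and its
  Schur complement is minus the kernel matrix. Each point therefore contributes a factor -1.\<close>

lemma path_det_fixed_index:
  assumes M: "M \<ge> 1" and nonsing: "Determinant.det (end_matrix \<mu> \<phi> n M a b) \<noteq> 0"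
  shows "path_det \<mu> \<phi> n M a b x (fixed_index M k) =
    Determinant.det (end_matrix \<mu> \<phi> n M a b) * ((- 1) ^ card (fixed_index M k) *
      Determinant.det (block_matrix M k
        (\<lambda>(r, i) (s, j). correlation_kernel \<mu> \<phi> n M a b r (x (r, i)) s (x (s, j)))))"
proof -
  let ?T = "transition \<mu> \<phi>" and ?A = "end_matrix \<mu> \<phi> n M a b"
  let ?es = "map (Pair (int M)) [0..<n]" and ?bs = "block_labels M k"
  let ?m = "length ?bs"
  let ?g = "path_entry \<mu> \<phi> M a b x"
  let ?K = "block_matrix M k (\<lambda>(r, i) (s, j). correlation_kernel \<mu> \<phi> n M a b r (x (r, i)) s (x (s, j)))"
  let ?B = "mat n ?m (\<lambda>(i, q). ?T (- int M) (fst (?bs ! q)) (a i) (x (?bs ! q)))"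
  let ?C = "mat ?m n (\<lambda>(p, j). ?T (fst (?bs ! p)) (int M) (x (?bs ! p)) (b j))"
  let ?D = "mat ?m ?m (\<lambda>(p, q). ?T (fst (?bs ! p)) (fst (?bs ! q)) (x (?bs ! p)) (x (?bs ! q)))"
  have A: "?A \<in> carrier_mat n n" by (simp add: end_matrix_def)
  \<comment> \<open>Nonsingularity guarantees that \<open>the (mat_inverse ...)\<close> in the
    kernel is the genuine inverse.\<close>
  obtain A' where A': "mat_inverse ?A = Some A'"
    using mat_inverse(1)[OF A, where b = "()"] det_non_zero_imp_unit[OF A nonsing, where b = "()"]
    by (cases "mat_inverse ?A") auto
  note inv = mat_inverse(2)[OF A A']
  have bs: "- int M < fst (?bs ! p) \<and> fst (?bs ! p) < int M" if "p < ?m" for p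
  proof -
    have "?bs ! p \<in> fixed_index M k" using nth_mem[OF that] by (simp only: set_block_labels)
    then show ?thesis by (cases "?bs ! p") (auto simp: fixed_index_def)
  qed
  have "distinct (?es @ ?bs)"
    by (simp add: distinct_map inj_on_def distinct_block_labels set_block_labels)
       (auto simp: fixed_index_def)
  moreover have "set (?es @ ?bs) = terminal_index n M \<union> fixed_index M k"
    by (auto simp: terminal_index_def set_block_labels)
  ultimately have "path_det \<mu> \<phi> n M a b x (fixed_index M k) =
      Determinant.det (mat (n + ?m) (n + ?m) (\<lambda>(i, j). ?g ((?es @ ?bs) ! i) ((?es @ ?bs) ! j)))"
    using set_det_conv_det[of "?es @ ?bs" ?g] by (simp add: path_det_def)
  also have "mat (n + ?m) (n + ?m) (\<lambda>(i, j). ?g ((?es @ ?bs) ! i) ((?es @ ?bs) ! j)) =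
      four_block_mat ?A ?B ?C ?D"
  proof (rule eq_matI)
    have pos: "row_time M (?bs ! p) = fst (?bs ! p)"
      "position M a b x (fst (?bs ! p)) (snd (?bs ! p)) = x (?bs ! p)" if "p < ?m" for p
      using bs[OF that] by (auto simp: row_time_def position_def)
    fix i j assume "i < dim_row (four_block_mat ?A ?B ?C ?D)" "j < dim_col (four_block_mat ?A ?B ?C ?D)"
    then have "i < n + ?m" "j < n + ?m" by (auto simp: end_matrix_def)
    moreover have "row_time M (int M, l) = - int M" "position M a b x (- int M) l = a l"
      "position M a b x (int M) l = b l" for l
      using M by (simp_all add: row_time_def position_def)
    ultimately show "mat (n + ?m) (n + ?m) (\<lambda>(i, j). ?g ((?es @ ?bs) ! i) ((?es @ ?bs) ! j)) $$ (i, j) =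
        four_block_mat ?A ?B ?C ?D $$ (i, j)"
      using pos[of "i - n"] pos[of "j - n"]
      by (cases "i < n"; cases "j < n") (simp_all add: end_matrix_def nth_append path_entry_def)
  qed (auto simp: end_matrix_def)
  also have "Determinant.det (four_block_mat ?A ?B ?C ?D) =
      Determinant.det ?A * Determinant.det (?D - ?C * A' * ?B)"
    by (rule det_four_block_mat_Schur[OF A]) (use inv in auto)
  also have "?D - ?C * A' * ?B = (- 1) \<cdot>\<^sub>m ?K"
  proof (rule eq_matI)
    fix p q assume "p < dim_row ((- 1) \<cdot>\<^sub>m ?K)" "q < dim_col ((- 1) \<cdot>\<^sub>m ?K)"
    then have pq: "p < ?m" "q < ?m" by (auto simp: block_matrix_def)
    have "(?C * A' * ?B) $$ (p, q) = (\<Sum>j<n. \<Sum>i<n. ?T (fst (?bs ! p)) (int M) (x (?bs ! p)) (b i) *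
        A' $$ (i, j) * ?T (- int M) (fst (?bs ! q)) (a j) (x (?bs ! q)))"
      using pq inv by (auto simp: scalar_prod_def sum_distrib_right atLeast0LessThan intro!: sum.cong)
    also have "\<dots> = (\<Sum>i<n. \<Sum>j<n. ?T (fst (?bs ! p)) (int M) (x (?bs ! p)) (b i) *
        A' $$ (i, j) * ?T (- int M) (fst (?bs ! q)) (a j) (x (?bs ! q)))"
      by (rule sum.swap)
    finally show "(?D - ?C * A' * ?B) $$ (p, q) = ((- 1) \<cdot>\<^sub>m ?K) $$ (p, q)"
      using pq inv A' by (auto simp: block_matrix_def correlation_kernel_def split_beta)
  qed (use inv in \<open>auto simp: block_matrix_def\<close>)
  also have "Determinant.det ((- 1) \<cdot>\<^sub>m ?K) = (- 1) ^ card (fixed_index M k) * Determinant.det ?K"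
    using distinct_card[OF distinct_block_labels[of M k]] by (simp add: block_matrix_def set_block_labels)
  finally show ?thesis .
qed

end

section \<open>Signs and factorials left by the free particles\<close>

lemma prod_neg_diff_eq_fact:
  "(\<Prod>i<m. - (of_nat m - of_nat i) :: 'a::comm_ring_1) = (- 1) ^ m * of_nat (fact m)"
proof (induction m)
  case (Suc m)
  \<comment> \<open>The factor at \<open>i = 0\<close> is split off, as the shifted remaining
    factors are those for \<open>m\<close>.\<close>
  have "(\<Prod>i<Suc m. - (of_nat (Suc m) - of_nat i) :: 'a) =
      - of_nat (Suc m) * (\<Prod>i<m. - (of_nat m - of_nat i))"
    by (subst prod.lessThan_Suc_shift) (simp add: o_def)
  also have "\<dots> = (- 1) ^ Suc m * of_nat (fact (Suc m))"
    unfolding Suc.IH by (simp add: algebra_simps)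
  finally show ?case .
qed simp

lemma fixed_free_index:
  assumes "\<And>r. \<bar>r\<bar> < int M \<Longrightarrow> k r \<le> n"
  shows "fixed_index M k \<union> free_index n M k = config_index n M"
    and "fixed_index M k \<inter> free_index n M k = {}"
proof -
  have k: "k r \<le> n" if "- int M < r" "r < int M" for r using assms that by auto
  show "fixed_index M k \<union> free_index n M k = config_index n M"
    by (auto simp: fixed_index_def free_index_def config_index_def intro: less_le_trans[OF _ k])
  show "fixed_index M k \<inter> free_index n M k = {}"
    by (auto simp: fixed_index_def free_index_def)
qed

context transition_weights
begin

text \<open>At time \<open>r\<close> the successive factors of \<open>integral_path_det\<close> are
  the negatives of \<open>n - k r\<close>, ..., 1, which multiply to a signed factorial.\<close>

lemma integral_path_weight:
  assumes M: "M \<ge> 1" and k: "\<And>r. \<bar>r\<bar> < int M \<Longrightarrow> k r \<le> n"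
  shows "(\<integral>y. path_weight \<phi> n M a b (merge (fixed_index M k) (free_index n M k) (x, y))
        \<partial>(\<Pi>\<^sub>M p\<in>free_index n M k. \<mu>)) =
    of_int (sign (advance n M)) *
      ((\<Prod>r\<in>{- int M <..< int M}. (- 1) ^ (n - k r) * fact (n - k r)) *
        path_det \<mu> \<phi> n M a b x (fixed_index M k))"
proof -
  let ?P = "fixed_index M k" and ?F = "free_index n M k"
  have PF: "?P \<union> ?F = config_index n M" "?P \<inter> ?F = {}"
    using fixed_free_index[of M k n] k by blast+
  have "(\<integral>y. path_det \<mu> \<phi> n M a b (merge ?P ?F (x, y)) (?P \<union> ?F) \<partial>(\<Pi>\<^sub>M p\<in>?F. \<mu>)) =
      (\<Prod>r\<in>{- int M <..< int M}. \<Prod>i<card {u \<in> ?F. fst u = r}.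
        - (of_nat n - of_nat (card {u \<in> ?P. fst u = r}) - of_nat i)) * path_det \<mu> \<phi> n M a b x ?P"
    using PF by (intro integral_path_det) auto
  also have "(\<Prod>r\<in>{- int M <..< int M}. \<Prod>i<card {u \<in> ?F. fst u = r}.
        - (of_nat n - of_nat (card {u \<in> ?P. fst u = r}) - of_nat i)) =
      (\<Prod>r\<in>{- int M <..< int M}. (- 1) ^ (n - k r) * fact (n - k r) :: complex)"
  proof (intro prod.cong refl)
    fix r assume r: "r \<in> {- int M <..< int M}"
    then have "k r \<le> n" using k by auto
    have "{u \<in> ?F. fst u = r} = Pair r ` {k r..<n}" "{u \<in> ?P. fst u = r} = Pair r ` {..<k r}"
      using r by (auto simp: free_index_def fixed_index_def)
    then have card: "card {u \<in> ?F. fst u = r} = n - k r" "card {u \<in> ?P. fst u = r} = k r"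
      by (simp_all add: card_image inj_on_def)
    have "(of_nat n - of_nat (k r) :: complex) = of_nat (n - k r)"
      using \<open>k r \<le> n\<close> by (simp add: of_nat_diff)
    then show "(\<Prod>i<card {u \<in> ?F. fst u = r}. - (of_nat n - of_nat (card {u \<in> ?P. fst u = r}) - of_nat i)) =
        ((- 1) ^ (n - k r) * fact (n - k r) :: complex)"
      using prod_neg_diff_eq_fact[of "n - k r", where 'a = complex] by (simp only: card of_nat_fact)
  qed
  finally show ?thesis
    unfolding path_weight_eq_path_det[OF M] PF(1) integral_mult_right_zero by (simp only: PF(1))
qed

text \<open>This is the case in which no particle is fixed. It shows that the partition function is
  a nonzero multiple of the determinant of the end matrix.\<close>

lemma integral_path_weight_config:
  assumes M: "M \<ge> 1"
  shows "(\<integral>y. path_weight \<phi> n M a b y \<partial>(\<Pi>\<^sub>M p\<in>config_index n M. \<mu>)) =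
    of_int (sign (advance n M)) *
      ((\<Prod>r\<in>{- int M <..< int M}. (- 1) ^ n * fact n) * Determinant.det (end_matrix \<mu> \<phi> n M a b))"
proof -
  have idx: "fixed_index M (\<lambda>_. 0) = {}" "free_index n M (\<lambda>_. 0) = config_index n M"
    by (auto simp: fixed_index_def free_index_def config_index_def)
  have "path_weight \<phi> n M a b y = path_weight \<phi> n M a b (merge {} (config_index n M) (x, y))" for x y
    unfolding path_weight_eq_path_det[OF M] by (intro arg_cong2[of _ _ _ _ "(*)"] refl path_det_cong) simp
  then show ?thesis
    using integral_path_weight[OF M, where k = "\<lambda>_. 0" and n = n and a = a and b = b] by (simp add: idx path_det_empty[OF M])
qed

end

theorem theorem1p7:
  fixes n M :: nat
    and \<mu> :: "real measure"
    and \<phi> :: "int \<Rightarrow> real \<Rightarrow> real \<Rightarrow> complex"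
    and c d :: "int \<Rightarrow> real \<Rightarrow> real"
    and a b :: "nat \<Rightarrow> real"
    and k :: "int \<Rightarrow> nat"
    and x :: "int \<times> nat \<Rightarrow> real"
  assumes "n \<ge> 1" and "M \<ge> 1"
    and "sets \<mu> = sets borel" and "sigma_finite_measure \<mu>"
    and "\<And>r. - int M \<le> r \<Longrightarrow> r < int M \<Longrightarrow>
           (\<lambda>(u, v). \<phi> r u v) \<in> borel_measurable (\<mu> \<Otimes>\<^sub>M \<mu>)"
    and "\<And>r u v. - int M \<le> r \<Longrightarrow> r < int M \<Longrightarrow> norm (\<phi> r u v) \<le> c r u * d r v"
    and "\<And>r. - int M \<le> r \<Longrightarrow> r < int M \<Longrightarrow> integrable \<mu> (c r)"
    and "\<And>r. - int M \<le> r \<Longrightarrow> r < int M \<Longrightarrow>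
           d r \<in> borel_measurable \<mu> \<and> (\<exists>B. AE v in \<mu>. \<bar>d r v\<bar> \<le> B)"
    and "partition_function \<mu> \<phi> n M a b \<noteq> 0"
    and "\<And>r. \<bar>r\<bar> < int M \<Longrightarrow> k r \<le> n"
  shows "correlation_function \<mu> \<phi> n M a b k x =
    Determinant.det (block_matrix M k
      (\<lambda>(r, i) (s, j). correlation_kernel \<mu> \<phi> n M a b r (x (r, i)) s (x (s, j))))"
    (is "_ = ?K")
proof -
  interpret transition_weights \<mu> \<phi> M c d
    using assms by (intro transition_weights.intro transition_weights_axioms.intro) auto
  note M = \<open>M \<ge> 1\<close>
  let ?T = "{- int M <..< int M}" and ?P = "fixed_index M k" and ?F = "free_index n M k"
  let ?\<epsilon> = "of_int (sign (advance n M)) :: complex"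
  let ?\<Delta> = "Determinant.det (end_matrix \<mu> \<phi> n M a b)"
  let ?Z = "\<integral>y. path_weight \<phi> n M a b y \<partial>(\<Pi>\<^sub>M p\<in>config_index n M. \<mu>)"
  have k: "k r \<le> n" if "r \<in> ?T" for r using assms(10)[of r] that by auto
  have Z: "?Z = ?\<epsilon> * ((\<Prod>r\<in>?T. (- 1) ^ n * fact n) * ?\<Delta>)"
    by (rule integral_path_weight_config[OF M])
  have "?Z \<noteq> 0" using assms(9) by (auto simp: partition_function_def)
  then have "?\<Delta> \<noteq> 0" using Z by auto
  \<comment> \<open>The sign from the Schur complement is distributed over the times, to be combined
    with the signs of the integrated particles.\<close>
  have "(- 1 :: complex) ^ card ?P = (\<Prod>r\<in>?T. (- 1) ^ k r)"
    by (simp add: fixed_index_def card_SigmaI power_sum)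
  moreover have "(\<integral>y. path_weight \<phi> n M a b (merge ?P ?F (x, y)) \<partial>(\<Pi>\<^sub>M p\<in>?F. \<mu>)) =
      ?\<epsilon> * ((\<Prod>r\<in>?T. (- 1) ^ (n - k r) * fact (n - k r)) * path_det \<mu> \<phi> n M a b x ?P)"
    using M assms(10) by (rule integral_path_weight)
  ultimately have free: "(\<integral>y. path_weight \<phi> n M a b (merge ?P ?F (x, y)) \<partial>(\<Pi>\<^sub>M p\<in>?F. \<mu>)) =
      ?\<epsilon> * ((\<Prod>r\<in>?T. (- 1) ^ (n - k r) * fact (n - k r)) * (?\<Delta> * ((\<Prod>r\<in>?T. (- 1) ^ k r) * ?K)))"
    by (simp only: path_det_fixed_index[OF M \<open>?\<Delta> \<noteq> 0\<close>])
  \<comment> \<open>At each time the \<open>k r\<close> fixed and \<open>n - k r\<close> free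
    particles together give the sign \<open>(- 1) ^ n\<close>, and the factorials combine to
    \<open>fact n\<close>; the result no longer depends on \<open>k\<close>.\<close>
  have factors: "(\<Prod>r\<in>?T. fact n / fact (n - k r)) * ((\<Prod>r\<in>?T. (- 1) ^ (n - k r) * fact (n - k r)) *
      (\<Prod>r\<in>?T. (- 1) ^ k r)) = (\<Prod>r\<in>?T. (- 1) ^ n * fact n :: complex)"
    unfolding prod.distrib[symmetric]
  proof (intro prod.cong refl)
    fix r assume "r \<in> ?T"
    have "(- 1 :: complex) ^ (n - k r) * (- 1) ^ k r = (- 1) ^ n"
      using k[OF \<open>r \<in> ?T\<close>] by (simp flip: power_add)
    then show "fact n / fact (n - k r) * ((- 1) ^ (n - k r) * fact (n - k r) * (- 1) ^ k r) =
        ((- 1) ^ n * fact n :: complex)"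
      by (simp add: field_simps)
  qed
  have "(\<Prod>r\<in>?T. fact n / fact (n - k r)) *
      (\<integral>y. path_weight \<phi> n M a b (merge ?P ?F (x, y)) \<partial>(\<Pi>\<^sub>M p\<in>?F. \<mu>)) =
      ?\<epsilon> * (((\<Prod>r\<in>?T. fact n / fact (n - k r)) * ((\<Prod>r\<in>?T. (- 1) ^ (n - k r) * fact (n - k r)) *
        (\<Prod>r\<in>?T. (- 1) ^ k r))) * ?\<Delta>) * ?K"
    by (simp only: free mult_ac)
  also have "\<dots> = ?Z * ?K"
    by (simp only: factors Z)
  finally have "(\<Prod>r\<in>?T. fact n / fact (n - k r)) *
      (\<integral>y. path_weight \<phi> n M a b (merge ?P ?F (x, y)) \<partial>(\<Pi>\<^sub>M p\<in>?F. \<mu>)) = ?Z * ?K" .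
  \<comment> \<open>The power of \<open>fact n\<close> in the density cancels the one in the
    partition function, leaving the weight divided by its total integral.\<close>
  moreover have "correlation_function \<mu> \<phi> n M a b k x = (\<Prod>r\<in>?T. fact n / fact (n - k r)) *
      (\<integral>y. path_weight \<phi> n M a b (merge ?P ?F (x, y)) \<partial>(\<Pi>\<^sub>M p\<in>?F. \<mu>)) / ?Z"
    by (simp add: correlation_function_def path_density_def partition_function_def)
  ultimately show ?thesis using \<open>?Z \<noteq> 0\<close> by simp
qed

end
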